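(* Let $(a_m)_{m\in\mathbf Z}$, $(b_m)_{m\in\mathbf Z}$ be two sequences of the segments of billiard trajectories within the ellipsoid $\mathcal E$ in $\mathbf E^d$, sharing the same $d-1$ caustics. Suppose the pair $(a_0,b_0)$ is $s$-skew, and that by the sequence of reflections on quadrics $\mathcal Q^1,\dots,\mathcal Q^{s+1}$ the minimal billiard trajectory connecting $a_0$ to $b_0$ is realized. Then each pair $(a_m,b_m)$ is $s$-skew, and the minimal billiard trajectory connecting these two lines is determined by the sequence of reflections on the same quadrics $\mathcal Q^1,\dots,\mathcal Q^{s+1}$.
   Context: Let $\mathcal E$ belong to the confocal family $\mathcal Q_{\lambda}:\ \sum_{i=1}^d \frac{x_i^2}{a_i-\lambda}=1$ in $\mathbf E^d$, with distinct real constants $a_1,\dots,a_d$. Two lines intersecting at a point $P$ of a quadric $\mathcal Q$ satisfy the billiard reflection law on $\mathcal Q$ if they are coplanar with the normal to $\mathcal Q$ at $P$ and make congruent angles with it. A billiard trajectory within $\mathcal E$ is a polygonal line with vertices on $\mathcal E$ such that each pair of consecutive segments satisfies the reflection law on $\mathcal E$ and lies on the same side of the tangent hyperplane to $\mathcal E$ at the common endpoint. All segments of such a trajectory (extended to lines) are tangent to the same $d-1$ quadrics confocal with $\mathcal E$, called its caustics. Segments are identified with the lines containing them, and the sequences list consecutive segments. A billiard trajectory connecting a line $x$ to a line $y$ (with the given caustics), with reflections on confocal quadrics $\mathcal Q^1,\dots,\mathcal Q^k$, is a sequence of lines $x=\ell_0,\ell_1,\dots,\ell_k=y$ such that $\ell_{i-1},\ell_i$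 satisfy the reflection law on $\mathcal Q^i$; $k$ is its length. Two lines $x,y$ tangent to the same $d-1$ quadrics of the family are $s$-skew if $s$ is the smallest number such that there is a system of $s+1\le d-1$ quadrics of the confocal family for which $y$ is obtained from $x$ by consecutive reflections on them (intersecting lines are $0$-skew, coinciding lines $(-1)$-skew); a trajectory of length $s+1$ connecting $s$-skew lines is called minimal.
   Formalization: Lines carry a direction of travel, also in the reflection law, skewness and minimality (undirected, b_m = a_{2-m} is a counterexample); reflection and tangency at points at infinity are admitted, since connecting reflection points can escape to infinity; retracing a line is not a reflection. *)

theory Defs
  imports "HOL-Analysis.Analysis"
begin

subsection \<open>Directed lines\<close>

text \<open>
  A segment of a trajectory is identified with the line containing it, together with its direction
  of travel: a line (as a point set) paired with a unit direction vector.  The direction cannot be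
  dropped.  In the plane let \<open>b m\<close> be \<open>a (2 - m)\<close>, the trajectory \<open>a\<close> run backwards.  Then \<open>a 0\<close> and
  \<open>b 0\<close> are in general two different lines meeting on a confocal conic, whereas \<open>a 1\<close> and \<open>b 1\<close>
  coincide as undirected lines.
\<close>

type_synonym 'n dline = "(real^'n) set \<times> (real^'n)"

definition is_dline :: "'n::finite dline \<Rightarrow> bool" where
  "is_dline L \<longleftrightarrow> norm (snd L) = 1 \<and> (\<exists>p. fst L = range (\<lambda>t. p + t *\<^sub>R snd L))"

definition dline_through :: "real^'n \<Rightarrow> real^'n \<Rightarrow> 'n::finite dline" where
  "dline_through P Q = (affine hull {P, Q}, sgn (Q - P))"


subsection \<open>The confocal family\<close>

text \<open>A quadric of the family is given by its parameter \<open>\<mu>\<close>, different from all \<open>\<alpha>\<^sub>i\<close>.\<close>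

definition regular_param :: "real^'n \<Rightarrow> real \<Rightarrow> bool" where
  "regular_param \<alpha> \<mu> \<longleftrightarrow> (\<forall>i. \<mu> \<noteq> \<alpha> $ i)"

definition confocal_quadric :: "real^'n \<Rightarrow> real \<Rightarrow> (real^'n::finite) set" where
  "confocal_quadric \<alpha> \<mu> = {x. (\<Sum>i\<in>UNIV. (x $ i)\<^sup>2 / (\<alpha> $ i - \<mu>)) = 1}"

text \<open>
  Half the gradient of the quadratic form.  At \<open>P\<close> on the quadric it is a normal vector, and the
  tangent hyperplane at \<open>P\<close> is \<open>{y. quadric_normal \<alpha> \<mu> P \<bullet> y = 1}\<close>.
\<close>

definition quadric_normal :: "real^'n \<Rightarrow> real \<Rightarrow> real^'n \<Rightarrow> real^'n" where
  "quadric_normal \<alpha> \<mu> x = (\<chi> i. x $ i / (\<alpha> $ i - \<mu>))"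

text \<open>
  The projective closure of the quadric contains the point at infinity in direction \<open>v \<noteq> 0\<close> iff
  \<open>(\<Sum>i. v\<^sub>i\<^sup>2 / (\<alpha>\<^sub>i - \<mu>)) = 0\<close>; its tangent hyperplane there is
  \<open>{y. quadric_normal \<alpha> \<mu> v \<bullet> y = 0}\<close>.
\<close>

definition ideal_point_on :: "real^'n \<Rightarrow> real \<Rightarrow> real^'n::finite \<Rightarrow> bool" where
  "ideal_point_on \<alpha> \<mu> v \<longleftrightarrow> v \<noteq> 0 \<and> (\<Sum>i\<in>UNIV. (v $ i)\<^sup>2 / (\<alpha> $ i - \<mu>)) = 0"


subsection \<open>Reflection law\<close>

text \<open>
  Incoming line \<open>L\<close>, outgoing line \<open>M\<close>, both through \<open>P\<close>.  The angles compared are those of the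
  unit vectors \<open>- snd L\<close> and \<open>snd M\<close> with the normal.  The last conjunct excludes the solution
  in which the incoming line is merely traversed backwards; this is a genuine reflection only
  if the line is normal to the quadric.
\<close>

definition reflection_law_at ::
    "real^'n \<Rightarrow> real \<Rightarrow> real^'n \<Rightarrow> 'n::finite dline \<Rightarrow> 'n dline \<Rightarrow> bool" where
  "reflection_law_at \<alpha> \<mu> P L M \<longleftrightarrow>
     (let n = quadric_normal \<alpha> \<mu> P in
        P \<in> confocal_quadric \<alpha> \<mu> \<and> P \<in> fst L \<and> P \<in> fst M \<and>
        coplanar (fst L \<union> fst M \<union> range (\<lambda>t. P + t *\<^sub>R n)) \<and>
        arccos ((- snd L \<bullet> n) / norm n) = arccos ((snd M \<bullet> n) / norm n) \<and>
        (snd M = - snd L \<longrightarrow> (\<exists>c. snd L = c *\<^sub>R n)))"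

definition mirror :: "real^'n \<Rightarrow> real \<Rightarrow> real^'n \<Rightarrow> real^'n::finite" where
  "mirror n c y = y - (2 * (n \<bullet> y - c) / (n \<bullet> n)) *\<^sub>R n"

text \<open>
  For a finite point the law says that \<open>M\<close> is the mirror image of \<open>L\<close> in the tangent hyperplane
  (\<open>reflection_law_at_iff_mirror\<close> below).  In this form it extends to a point at infinity,
  where the direction of the line is unchanged because it lies in the tangent hyperplane.  This
  extension is needed because a line of a trajectory, while keeping its caustics, can become
  parallel to an asymptotic direction of a confocal hyperboloid, and its
  point of reflection then moves to infinity.
\<close>

definition reflection_law_ideal ::
    "real^'n \<Rightarrow> real \<Rightarrow> 'n::finite dline \<Rightarrow> 'n dline \<Rightarrow> bool" where
  "reflection_law_ideal \<alpha> \<mu> L M \<longleftrightarrow>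
     ideal_point_on \<alpha> \<mu> (snd L) \<and> snd M = snd L \<and>
     fst M = mirror (quadric_normal \<alpha> \<mu> (snd L)) 0 ` fst L"

definition reflection_law :: "real^'n \<Rightarrow> real \<Rightarrow> 'n::finite dline \<Rightarrow> 'n dline \<Rightarrow> bool" where
  "reflection_law \<alpha> \<mu> L M \<longleftrightarrow>
     (\<exists>P. reflection_law_at \<alpha> \<mu> P L M) \<or> reflection_law_ideal \<alpha> \<mu> L M"


subsection \<open>Caustics\<close>

text \<open>The second alternative is tangency at infinity: the line is an asymptote of the quadric.\<close>

definition tangent_to_quadric :: "real^'n \<Rightarrow> real \<Rightarrow> 'n::finite dline \<Rightarrow> bool" where
  "tangent_to_quadric \<alpha> \<mu> L \<longleftrightarrow>
     (\<exists>P \<in> fst L \<inter> confocal_quadric \<alpha> \<mu>. quadric_normal \<alpha> \<mu> P \<bullet> snd L = 0) \<or>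
     (ideal_point_on \<alpha> \<mu> (snd L) \<and> (\<forall>y \<in> fst L. quadric_normal \<alpha> \<mu> (snd L) \<bullet> y = 0))"

definition caustic_params :: "real^'n \<Rightarrow> real set \<Rightarrow> bool" where
  "caustic_params \<alpha> C \<longleftrightarrow>
     finite C \<and> card C = CARD('n) - 1 \<and> (\<forall>c\<in>C. regular_param \<alpha> c)"

definition has_caustics :: "real^'n \<Rightarrow> real set \<Rightarrow> 'n::finite dline \<Rightarrow> bool" where
  "has_caustics \<alpha> C L \<longleftrightarrow> (\<forall>c\<in>C. tangent_to_quadric \<alpha> c L)"


subsection \<open>Billiard trajectories within an ellipsoid\<close>

definition same_side_of_tangent_hyperplane ::
    "real^'n \<Rightarrow> real \<Rightarrow> real^'n \<Rightarrow> (real^'n::finite) set \<Rightarrow> bool" where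
  "same_side_of_tangent_hyperplane \<alpha> \<mu> P S \<longleftrightarrow>
     (\<forall>y\<in>S. quadric_normal \<alpha> \<mu> P \<bullet> y \<le> 1) \<or> (\<forall>y\<in>S. quadric_normal \<alpha> \<mu> P \<bullet> y \<ge> 1)"

definition billiard_within :: "real^'n \<Rightarrow> real \<Rightarrow> (int \<Rightarrow> 'n::finite dline) \<Rightarrow> bool" where
  "billiard_within \<alpha> \<epsilon> L \<longleftrightarrow>
     (\<exists>P :: int \<Rightarrow> real^'n. \<forall>m.
        P m \<in> confocal_quadric \<alpha> \<epsilon> \<and> P m \<noteq> P (m + 1) \<and>
        L m = dline_through (P m) (P (m + 1)) \<and>
        reflection_law_at \<alpha> \<epsilon> (P (m + 1)) (L m) (L (m + 1)) \<and>
        same_side_of_tangent_hyperplane \<alpha> \<epsilon> (P (m + 1))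
          (closed_segment (P m) (P (m + 1)) \<union> closed_segment (P (m + 1)) (P (m + 2))))"


subsection \<open>Trajectories with reflections on several quadrics, skew lines\<close>

text \<open>The quadrics are listed by their parameters \<open>\<Lambda>\<close>.\<close>

definition connecting_trajectory ::
    "real^'n \<Rightarrow> real set \<Rightarrow> real list \<Rightarrow> 'n::finite dline list \<Rightarrow> 'n dline \<Rightarrow> 'n dline \<Rightarrow> bool" where
  "connecting_trajectory \<alpha> C \<Lambda> Ls x y \<longleftrightarrow>
     length Ls = length \<Lambda> + 1 \<and> Ls ! 0 = x \<and> Ls ! length \<Lambda> = y \<and>
     (\<forall>L \<in> set Ls. is_dline L \<and> has_caustics \<alpha> C L) \<and>
     (\<forall>\<mu> \<in> set \<Lambda>. regular_param \<alpha> \<mu>) \<and>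
     (\<forall>k < length \<Lambda>. reflection_law \<alpha> (\<Lambda> ! k) (Ls ! k) (Ls ! (k + 1)))"

definition connects_via ::
    "real^'n \<Rightarrow> real set \<Rightarrow> real list \<Rightarrow> 'n::finite dline \<Rightarrow> 'n dline \<Rightarrow> bool" where
  "connects_via \<alpha> C \<Lambda> x y \<longleftrightarrow> (\<exists>Ls. connecting_trajectory \<alpha> C \<Lambda> Ls x y)"

text \<open>The integer \<open>s\<close> is at least \<open>-1\<close>, and \<open>s = -1\<close> means that the lines coincide.\<close>

definition skew_lines ::
    "real^'n \<Rightarrow> real set \<Rightarrow> int \<Rightarrow> 'n::finite dline \<Rightarrow> 'n dline \<Rightarrow> bool" where
  "skew_lines \<alpha> C s x y \<longleftrightarrow>
     s + 1 \<le> int (CARD('n)) - 1 \<and>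
     (\<exists>\<Lambda>. int (length \<Lambda>) = s + 1 \<and> connects_via \<alpha> C \<Lambda> x y) \<and>
     (\<forall>\<Lambda>. connects_via \<alpha> C \<Lambda> x y \<longrightarrow> s + 1 \<le> int (length \<Lambda>))"

definition minimal_trajectory_via ::
    "real^'n \<Rightarrow> real set \<Rightarrow> int \<Rightarrow> real list \<Rightarrow> 'n::finite dline \<Rightarrow> 'n dline \<Rightarrow> bool" where
  "minimal_trajectory_via \<alpha> C s \<Lambda> x y \<longleftrightarrow>
     skew_lines \<alpha> C s x y \<and> int (length \<Lambda>) = s + 1 \<and> connects_via \<alpha> C \<Lambda> x y"


subsection \<open>The reflection law as mirror image\<close>

lemma inner_quadric_normal:
  "quadric_normal \<alpha> \<mu> P \<bullet> P = (\<Sum>i\<in>UNIV. (P $ i)\<^sup>2 / (\<alpha> $ i - \<mu>))"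
  by (simp add: quadric_normal_def inner_vec_def power2_eq_square)

lemma dline_eq_range:
  assumes "is_dline L" "P \<in> fst L"
  shows "fst L = range (\<lambda>t. P + t *\<^sub>R snd L)"
proof -
  obtain p where p: "fst L = range (\<lambda>t. p + t *\<^sub>R snd L)"
    using assms(1) by (auto simp: is_dline_def)
  then obtain t0 where t0: "P = p + t0 *\<^sub>R snd L" using assms(2) by auto
  have "p + t *\<^sub>R snd L \<in> range (\<lambda>t. P + t *\<^sub>R snd L)" for t
    by (rule range_eqI[of _ _ "t - t0"]) (simp add: t0 algebra_simps)
  moreover have "P + t *\<^sub>R snd L \<in> range (\<lambda>t. p + t *\<^sub>R snd L)" for t
    by (rule range_eqI[of _ _ "t + t0"]) (simp add: t0 algebra_simps)
  ultimately show ?thesis unfolding p by (intro subset_antisym image_subsetI)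
qed

lemma coplanar_dependent:
  fixes P v u n :: "'a::euclidean_space"
  assumes "coplanar S" "{P, P + v, P + u, P + n} \<subseteq> S"
  shows "dim {v, u, n} \<le> 2"
proof -
  obtain x1 x2 x3 where "S \<subseteq> affine hull {x1, x2, x3}" using assms(1) by (auto simp: coplanar_def)
  then have "{P, P + v, P + u, P + n} \<subseteq> affine hull {x1, x2, x3}" using assms(2) by blast
  then have "aff_dim {P, P + v, P + u, P + n} \<le> aff_dim {x1, x2, x3}"
    using aff_dim_affine_hull aff_dim_subset by metis
  also have "\<dots> \<le> int (card {x1, x2, x3}) - 1" by (rule aff_dim_le_card) simp
  also have "\<dots> \<le> 2" using card_insert_le_m1[of 3 "{x2, x3}" x1] card_insert_le_m1[of 2 "{x3}" x2] by simp
  finally have "aff_dim {P, P + v, P + u, P + n} \<le> 2" .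
  moreover have "{P, P + v, P + u, P + n} = (+) P ` {0, v, u, n}" by simp
  ultimately have "aff_dim {0, v, u, n} \<le> 2" by (metis aff_dim_translation_eq)
  moreover have "aff_dim {0, v, u, n} = int (dim {0, v, u, n})"
    by (rule aff_dim_zero) (simp add: hull_inc)
  ultimately show ?thesis by (simp add: dim_insert span_0)
qed

lemma coplanar_reflection:
  fixes v u n :: "'a::euclidean_space"
  assumes dim: "dim {v, u, n} \<le> 2" and nv: "norm v = 1" "norm u = 1" and n: "n \<noteq> 0"
    and angle: "u \<bullet> n = - (v \<bullet> n)" and turn: "u = - v \<longrightarrow> (\<exists>c. v = c *\<^sub>R n)"
  shows "u = v - (2 * (n \<bullet> v) / (n \<bullet> n)) *\<^sub>R n"
proof -
  have vv: "v \<bullet> v = 1" "u \<bullet> u = 1" using nv by (simp_all add: norm_eq_1)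
  have nn: "n \<bullet> n \<noteq> 0" using n by simp
  define w where "w = v - ((n \<bullet> v) / (n \<bullet> n)) *\<^sub>R n"
  define z where "z = u + ((n \<bullet> v) / (n \<bullet> n)) *\<^sub>R n"
  have wn: "w \<bullet> n = 0" "z \<bullet> n = 0" using nn angle
    by (simp_all add: w_def z_def inner_diff_left inner_add_left inner_diff_right inner_add_right inner_commute)
  have wz: "w \<bullet> w = z \<bullet> z"
    using nn angle vv
    by (simp add: w_def z_def inner_diff_left inner_diff_right inner_add_left inner_add_right
        inner_commute algebra_simps)
  have "z = w"
  proof (cases "w = 0")
    case True
    then show ?thesis using wz by simp
  next
    case False
    have "\<exists>c. z = c *\<^sub>R w"
    proof -
      define y where "y = z - ((z \<bullet> w) / (w \<bullet> w)) *\<^sub>R w"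
      have yo: "y \<bullet> n = 0" "y \<bullet> w = 0"
        using wn False by (simp_all add: y_def inner_diff_left)
      have "y = 0"
      proof (rule ccontr)
        assume y: "y \<noteq> 0"
        have po: "pairwise orthogonal {y, w, n}"
          using yo wn by (auto simp: pairwise_insert orthogonal_def inner_commute)
        have "independent {y, w, n}"
          by (rule pairwise_orthogonal_independent[OF po]) (use y False n in auto)
        moreover have "card {y, w, n} = 3"
          using yo wn y False n by (auto simp: card_insert_if)
        ultimately have "dim {y, w, n} = 3" using dim_eq_card_independent by metis
        moreover have "{y, w, n} \<subseteq> span {v, u, n}"
          unfolding y_def w_def z_def
          by (auto intro!: span_diff span_add span_scale intro: span_base)
        then have "dim {y, w, n} \<le> dim {v, u, n}"
          using dim_subset dim_span by metis
        ultimately show False using dim by simp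
      qed
      then show ?thesis by (auto simp: y_def)
    qed
    then obtain c where c: "z = c *\<^sub>R w" by blast
    have "c\<^sup>2 * (w \<bullet> w) = w \<bullet> w" using wz unfolding c by (simp add: power2_eq_square)
    then have "c\<^sup>2 = 1" using False by simp
    then have "c = 1 \<or> c = -1" by (simp add: power2_eq_1_iff)
    moreover have "c \<noteq> -1"
    proof
      assume "c = -1"
      then have "u = - v" using c by (simp add: w_def z_def algebra_simps add_eq_0_iff)
      then obtain d where d: "v = d *\<^sub>R n" using turn by blast
      then have "w = 0" using nn by (simp add: w_def)
      then show False using False by simp
    qed
    ultimately show ?thesis using c by simp
  qed
  then have "u = v - ((n \<bullet> v) / (n \<bullet> n)) *\<^sub>R n - ((n \<bullet> v) / (n \<bullet> n)) *\<^sub>R n"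
    by (simp add: w_def z_def algebra_simps)
  also have "\<dots> = v - (2 * ((n \<bullet> v) / (n \<bullet> n))) *\<^sub>R n"
    by (simp add: scaleR_left_distrib[symmetric] diff_diff_eq)
  finally show ?thesis by simp
qed

lemma reflection_law_at_iff_mirror:
  fixes \<alpha> P :: "real^'n::finite" and L M :: "'n dline"
  assumes L: "is_dline L" and M: "is_dline M"
    and P: "P \<in> confocal_quadric \<alpha> \<mu>" "P \<in> fst L"
  defines "n \<equiv> quadric_normal \<alpha> \<mu> P"
  shows "reflection_law_at \<alpha> \<mu> P L M \<longleftrightarrow>
     fst M = mirror n 1 ` fst L \<and> snd M = mirror n 0 (snd L)"
proof -
  obtain l v where Lv: "L = (l, v)" by (cases L)
  obtain m u where Mu: "M = (m, u)" by (cases M)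
  have l: "l = range (\<lambda>t. P + t *\<^sub>R v)" using dline_eq_range[OF L P(2)] by (simp add: Lv)
  have nv: "norm v = 1" "norm u = 1" using L M by (simp_all add: is_dline_def Lv Mu)
  have nP: "n \<bullet> P = 1" using P(1) by (simp add: n_def inner_quadric_normal confocal_quadric_def)
  then have n: "n \<noteq> 0" by auto
  then have nn: "n \<bullet> n \<noteq> 0" by simp
  have mir: "mirror n 1 (P + t *\<^sub>R v) = P + t *\<^sub>R mirror n 0 v" for t
    by (simp add: mirror_def inner_add_right nP algebra_simps)
  have mirl: "mirror n 1 ` l = range (\<lambda>t. P + t *\<^sub>R mirror n 0 v)"
    by (simp add: l image_image mir)
  have bnd: "\<bar>x \<bullet> n / norm n\<bar> \<le> 1" if "norm x = 1" for x
    using Cauchy_Schwarz_ineq2[of x n] that n by simp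
  have ang: "arccos ((- v \<bullet> n) / norm n) = arccos ((u \<bullet> n) / norm n) \<longleftrightarrow> u \<bullet> n = - (v \<bullet> n)"
  proof -
    have "arccos ((- v \<bullet> n) / norm n) = arccos ((u \<bullet> n) / norm n) \<longleftrightarrow>
        (- v \<bullet> n) / norm n = (u \<bullet> n) / norm n"
      by (rule arccos_eq_iff) (use bnd[of "- v"] bnd[of u] nv in simp)
    also have "\<dots> \<longleftrightarrow> - v \<bullet> n = u \<bullet> n" using n by (simp only: divide_cancel_right norm_eq_zero) simp
    finally show ?thesis by auto
  qed
  show ?thesis
  proof
    assume R: "reflection_law_at \<alpha> \<mu> P L M"
    then have Pm: "P \<in> m" and cop: "coplanar (l \<union> m \<union> range (\<lambda>t. P + t *\<^sub>R n))"
      and un: "u \<bullet> n = - (v \<bullet> n)" and turn: "u = - v \<longrightarrow> (\<exists>c. v = c *\<^sub>R n)"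
      using ang by (auto simp: reflection_law_at_def n_def[symmetric] Let_def Lv Mu)
    have m: "m = range (\<lambda>t. P + t *\<^sub>R u)" using dline_eq_range[OF M] Pm by (simp add: Mu)
    have "{P, P + v, P + u, P + n} \<subseteq> l \<union> m \<union> range (\<lambda>t. P + t *\<^sub>R n)"
      using rangeI[of "\<lambda>t. P + t *\<^sub>R v" 0] rangeI[of "\<lambda>t. P + t *\<^sub>R v" 1]
        rangeI[of "\<lambda>t. P + t *\<^sub>R u" 1] rangeI[of "\<lambda>t. P + t *\<^sub>R n" 1]
      by (simp add: l m)
    then have "dim {v, u, n} \<le> 2" by (rule coplanar_dependent[OF cop])
    then have "u = mirror n 0 v"
      using coplanar_reflection[OF _ nv n un turn] by (simp add: mirror_def)
    then show "fst M = mirror n 1 ` fst L \<and> snd M = mirror n 0 (snd L)"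
      by (simp add: Lv Mu mirl m)
  next
    assume "fst M = mirror n 1 ` fst L \<and> snd M = mirror n 0 (snd L)"
    then have u: "u = mirror n 0 v" and m: "m = range (\<lambda>t. P + t *\<^sub>R u)"
      by (simp_all add: Lv Mu mirl)
    have Pm: "P \<in> m" using rangeI[of "\<lambda>t. P + t *\<^sub>R u" 0] by (simp add: m)
    have un: "u \<bullet> n = - (v \<bullet> n)" using nn
      by (simp add: u mirror_def inner_diff_left inner_diff_right inner_commute)
    have turn: "\<exists>c. v = c *\<^sub>R n" if "u = - v"
    proof -
      have "2 *\<^sub>R v = (2 * (n \<bullet> v) / (n \<bullet> n)) *\<^sub>R n"
        using that u by (simp add: mirror_def algebra_simps scaleR_2)
      then have "v = ((n \<bullet> v) / (n \<bullet> n)) *\<^sub>R n"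
        by (simp flip: scaleR_scaleR times_divide_eq_right)
      then show ?thesis by blast
    qed
    have pt: "P + s *\<^sub>R v + t *\<^sub>R n \<in> affine hull {P, P + v, P + n}" for s t
      unfolding affine_hull_3
      by (rule CollectI, rule exI[of _ "1 - s - t"], rule exI[of _ s], rule exI[of _ t])
        (simp add: algebra_simps)
    have "l \<union> m \<union> range (\<lambda>t. P + t *\<^sub>R n) \<subseteq> affine hull {P, P + v, P + n}"
    proof -
      have "P + t *\<^sub>R v \<in> affine hull {P, P + v, P + n}" for t using pt[of t 0] by simp
      moreover have "P + t *\<^sub>R n \<in> affine hull {P, P + v, P + n}" for t using pt[of 0 t] by simp
      moreover have "P + t *\<^sub>R u \<in> affine hull {P, P + v, P + n}" for t
      proof -
        have "P + t *\<^sub>R u = P + t *\<^sub>R v + (- (t * (2 * (n \<bullet> v) / (n \<bullet> n)))) *\<^sub>R n"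
          by (simp add: u mirror_def scaleR_diff_right)
        then show ?thesis using pt by metis
      qed
      ultimately show ?thesis by (auto simp: l m)
    qed
    then have "coplanar (l \<union> m \<union> range (\<lambda>t. P + t *\<^sub>R n))" by (auto simp: coplanar_def)
    then show "reflection_law_at \<alpha> \<mu> P L M"
      using P Pm un ang turn
      by (simp add: reflection_law_at_def n_def[symmetric] Let_def Lv Mu)
  qed
qed

end

theory Submission
  imports Defs
begin

text \<open>
  For a line with unit direction \<open>v\<close> the discriminant of its intersection with \<open>\<Q>\<^sub>\<nu>\<close> is unchanged by
  reflection on any confocal quadric. It vanishes iff the line touches \<open>\<Q>\<^sub>\<nu>\<close>, so caustics are
  preserved; and it is the square of \<open>\<delta> = n \<bullet> v\<close>, where \<open>n\<close> is the normal at either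
  intersection point, so the sign of \<open>\<delta>\<close> selects the point and gives a well-defined reflection,
  inverted by changing the sign. On the ellipsoid, leaving through a point means \<open>\<delta> > 0\<close>, and
  connected lines share the value of \<open>\<delta>\<close>. The reflections on two confocal quadrics with prescribed
  \<open>\<delta>\<close> commute, because the four tangent hyperplanes involved belong to a pencil. Hence the
  billiard step on the ellipsoid carries trajectories connecting \<open>a m\<close> to \<open>b m\<close> bijectively to
  trajectories on the same quadrics connecting \<open>a (m + 1)\<close> to \<open>b (m + 1)\<close>.
\<close>

section \<open>The quadric normal as a linear operator depending on the parameter\<close>

lemma quadric_normal_add:
  "quadric_normal \<alpha> \<mu> (x + y) = quadric_normal \<alpha> \<mu> x + quadric_normal \<alpha> \<mu> y"
  by (simp add: quadric_normal_def vec_eq_iff add_divide_distrib)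

lemma quadric_normal_scaleR: "quadric_normal \<alpha> \<mu> (k *\<^sub>R x) = k *\<^sub>R quadric_normal \<alpha> \<mu> x"
  by (simp add: quadric_normal_def vec_eq_iff)

lemma quadric_normal_diff:
  "quadric_normal \<alpha> \<mu> (x - y) = quadric_normal \<alpha> \<mu> x - quadric_normal \<alpha> \<mu> y"
  by (simp add: quadric_normal_def vec_eq_iff diff_divide_distrib)

lemmas quadric_normal_linear =
  quadric_normal_add quadric_normal_scaleR quadric_normal_diff

lemma quadric_normal_self_adjoint:
  fixes x :: "real^'n::finite"
  shows "quadric_normal \<alpha> \<mu> x \<bullet> y = quadric_normal \<alpha> \<mu> y \<bullet> x"
  by (simp add: quadric_normal_def inner_vec_def mult.commute)

lemma quadric_normal_eq_0:
  assumes "regular_param \<alpha> \<mu>" "quadric_normal \<alpha> \<mu> x = 0"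
  shows "x = 0"
  using assms by (simp add: quadric_normal_def vec_eq_iff regular_param_def) metis

text \<open>The resolvent identity: \<open>quadric_normal \<alpha> \<mu>\<close> is the inverse of
  \<open>A - \<mu> I\<close> for the diagonal matrix \<open>A\<close> with entries
  \<open>\<alpha> $ i\<close>. Confocality enters the computations with two different quadrics
  through this identity.\<close>

lemma quadric_normal_resolvent:
  assumes "regular_param \<alpha> \<mu>" "regular_param \<alpha> \<nu>"
  shows "(\<nu> - \<mu>) *\<^sub>R quadric_normal \<alpha> \<nu> (quadric_normal \<alpha> \<mu> x) =
    quadric_normal \<alpha> \<nu> x - quadric_normal \<alpha> \<mu> x"
proof -
  have "\<alpha> $ i - \<nu> \<noteq> 0" "\<alpha> $ i - \<mu> \<noteq> 0" for i
    using assms[unfolded regular_param_def, rule_format, of i] by auto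
  then show ?thesis
    by (simp add: quadric_normal_def vec_eq_iff divide_simps) (simp add: algebra_simps)
qed

subsection \<open>Reflection in hyperplanes\<close>

lemma mirror_scaleR:
  assumes "k \<noteq> 0"
  shows "mirror (k *\<^sub>R n) (k * c) y = mirror n c y"
proof -
  have "(2 * (k * (n \<bullet> y) - k * c) / (k * (k * (n \<bullet> n)))) * k = 2 * (n \<bullet> y - c) / (n \<bullet> n)"
    using assms by (simp add: divide_simps) (simp add: algebra_simps)
  then show ?thesis by (simp add: mirror_def)
qed

lemma mirror_mirror:
  assumes "n \<noteq> 0"
  shows "mirror n c (mirror n c y) = y"
proof -
  have nn: "n \<bullet> n \<noteq> 0" using assms by simp
  have "n \<bullet> mirror n c y - c = - (n \<bullet> y - c)"
    using nn by (simp add: mirror_def inner_diff_right)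
  then have "mirror n c (mirror n c y) = mirror n c y + (2 * (n \<bullet> y - c) / (n \<bullet> n)) *\<^sub>R n"
    unfolding mirror_def[of n c "mirror n c y"]
    by (simp only: mult_minus_right minus_divide_left[symmetric] scaleR_minus_left diff_minus_eq_add)
  then show ?thesis by (simp add: mirror_def)
qed

lemma mirror_along:
  "mirror n c (p + t *\<^sub>R v) = mirror n c p + t *\<^sub>R mirror n 0 v"
proof -
  have "2 * (n \<bullet> p + t * (n \<bullet> v) - c) / (n \<bullet> n)
      = 2 * (n \<bullet> p - c) / (n \<bullet> n) + t * (2 * (n \<bullet> v) / (n \<bullet> n))"
    by (simp add: add_divide_distrib diff_divide_distrib algebra_simps)
  then show ?thesis
    by (simp add: mirror_def inner_add_right scaleR_add_left algebra_simps)
qed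

lemma norm_mirror:
  assumes "n \<noteq> 0"
  shows "norm (mirror n 0 v) = norm v"
proof -
  have nn: "n \<bullet> n \<noteq> 0" using assms by simp
  have "mirror n 0 v \<bullet> mirror n 0 v = v \<bullet> v"
    using nn by (simp add: mirror_def inner_diff_left inner_diff_right inner_commute)
  then show ?thesis by (simp add: norm_eq_sqrt_inner)
qed

text \<open>A direction is moved by the linear part of the affine reflection, hence the offset
  0.\<close>

definition mirror_line :: "real^'n \<Rightarrow> real \<Rightarrow> 'n::finite dline \<Rightarrow> 'n dline" where
  "mirror_line n c L = (mirror n c ` fst L, mirror n 0 (snd L))"

text \<open>Points of reflection will be given by homogeneous coordinates. A common factor rescales
  normal and offset together and must not change the reflection.\<close>

lemma mirror_line_scaleR:
  assumes "k \<noteq> 0"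
  shows "mirror_line (k *\<^sub>R n) (k * c) L = mirror_line n c L"
  using mirror_scaleR[OF assms, of n c] mirror_scaleR[OF assms, of n 0]
  by (simp add: mirror_line_def)

lemma mirror_line_mirror_line:
  assumes "n \<noteq> 0"
  shows "mirror_line n c (mirror_line n c L) = L"
  by (simp add: mirror_line_def image_image mirror_mirror[OF assms])

lemma is_dline_mirror_line:
  assumes "is_dline L" "n \<noteq> 0"
  shows "is_dline (mirror_line n c L)"
proof -
  obtain p where "fst L = range (\<lambda>t. p + t *\<^sub>R snd L)" using assms(1) by (auto simp: is_dline_def)
  then have "mirror n c ` fst L = range (\<lambda>t. mirror n c p + t *\<^sub>R mirror n 0 (snd L))"
    by (simp add: image_image mirror_along)
  then show ?thesis
    using assms norm_mirror[OF assms(2)] by (auto simp: mirror_line_def is_dline_def)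
qed

text \<open>
  The reflections in the hyperplanes \<open>L\<close>, \<open>M\<close>, \<open>L + c M\<close>, \<open>M + d L\<close> of a pencil: the hypothesis
  on \<open>M \<bullet> L\<close> says that the angle from \<open>M\<close> to \<open>L + c M\<close> equals the angle from \<open>L\<close> to \<open>M + d L\<close>.
\<close>

lemma mirror_pencil:
  fixes L M x :: "real^'n::finite"
  assumes pencil: "2 * (M \<bullet> L) = - c * (M \<bullet> M) - d * (L \<bullet> L)"
    and nz: "M \<noteq> 0" "L \<noteq> 0" "L + c *\<^sub>R M \<noteq> 0"
  shows "mirror (L + c *\<^sub>R M) (l + c * m) (mirror M m x) =
    mirror (M + d *\<^sub>R L) (m + d * l) (mirror L l x)"
proof -
  define N K a b where "N = M \<bullet> M" "K = L \<bullet> L" "a = M \<bullet> x - m" "b = L \<bullet> x - l"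
  \<comment> \<open>By \<open>pencil\<close>, the squared norms of the two new normals are
    \<open>e\<close> times those of \<open>L\<close> and \<open>M\<close> respectively.\<close>
  define e where "e = 1 - c * d"
  note defs = N_K_a_b_def
  have NK: "N \<noteq> 0" "K \<noteq> 0" using nz by (simp_all add: defs)
  have "(L + c *\<^sub>R M) \<bullet> (L + c *\<^sub>R M) = K + c * (2 * (M \<bullet> L)) + c * c * N"
    by (simp add: defs inner_add_left inner_add_right inner_commute algebra_simps)
  also have "\<dots> = K * e" unfolding pencil by (simp add: defs e_def algebra_simps)
  finally have L': "(L + c *\<^sub>R M) \<bullet> (L + c *\<^sub>R M) = K * e" .
  then have e: "e \<noteq> 0" using nz(3) by (metis inner_eq_zero_iff mult_zero_right)
  have "(M + d *\<^sub>R L) \<bullet> (M + d *\<^sub>R L) = N + d * (2 * (M \<bullet> L)) + d * d * K"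
    by (simp add: defs inner_add_left inner_add_right inner_commute algebra_simps)
  also have "\<dots> = N * e" unfolding pencil by (simp add: defs e_def algebra_simps)
  finally have M': "(M + d *\<^sub>R L) \<bullet> (M + d *\<^sub>R L) = N * e" .
  have m1: "mirror M m x = x - (2 * a / N) *\<^sub>R M" and m2: "mirror L l x = x - (2 * b / K) *\<^sub>R L"
    by (simp_all add: mirror_def defs)
  have "(L + c *\<^sub>R M) \<bullet> mirror M m x - (l + c * m) = b + c * a - (a / N) * (2 * (M \<bullet> L) + 2 * c * N)"
    unfolding m1 using NK
    by (simp add: defs inner_add_left inner_add_right inner_diff_right inner_commute field_simps)
  also have "\<dots> = b + a * d * K / N"
    unfolding pencil using NK by (simp add: N_K_a_b_def(1,2)[symmetric] field_simps)
  finally have h1: "(L + c *\<^sub>R M) \<bullet> mirror M m x - (l + c * m) = b + a * d * K / N" .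
  have "(M + d *\<^sub>R L) \<bullet> mirror L l x - (m + d * l) = a + d * b - (b / K) * (2 * (M \<bullet> L) + 2 * d * K)"
    unfolding m2 using NK
    by (simp add: defs inner_add_left inner_add_right inner_diff_right inner_commute field_simps)
  also have "\<dots> = a + b * c * N / K"
    unfolding pencil using NK by (simp add: N_K_a_b_def(1,2)[symmetric] field_simps)
  finally have h2: "(M + d *\<^sub>R L) \<bullet> mirror L l x - (m + d * l) = a + b * c * N / K" .
  \<comment> \<open>These are the coefficients of the second reflection in the two compositions.
    Comparing the coefficients of \<open>L\<close> and \<open>M\<close> reduces the claim to
    \<open>s1\<close> and \<open>t1\<close>.\<close>
  define s t where "s = 2 * (b + a * d * K / N) / (K * e)" "t = 2 * (a + b * c * N / K) / (N * e)"
  have s1: "s = 2 * b / K + t * d"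
    unfolding s_t_def using NK e by (simp add: field_simps) (simp add: e_def algebra_simps)
  have t1: "t = 2 * a / N + s * c"
    unfolding s_t_def using NK e by (simp add: field_simps) (simp add: e_def algebra_simps)
  have "mirror (L + c *\<^sub>R M) (l + c * m) (mirror M m x) = x - (2 * a / N) *\<^sub>R M - s *\<^sub>R (L + c *\<^sub>R M)"
    unfolding mirror_def[of "L + c *\<^sub>R M"] h1 L' s_t_def by (simp only: m1)
  also have "\<dots> = x - (2 * a / N + s * c) *\<^sub>R M - s *\<^sub>R L" by (simp add: algebra_simps)
  also have "\<dots> = x - t *\<^sub>R M - (2 * b / K + t * d) *\<^sub>R L" using s1 t1 by simp
  also have "\<dots> = x - (2 * b / K) *\<^sub>R L - t *\<^sub>R (M + d *\<^sub>R L)" by (simp add: algebra_simps)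
  also have "\<dots> = mirror (M + d *\<^sub>R L) (m + d * l) (mirror L l x)"
    unfolding mirror_def[of "M + d *\<^sub>R L"] h2 M' s_t_def by (simp only: m2)
  finally show ?thesis .
qed

subsection \<open>Lines meeting confocal quadrics\<close>

text \<open>
  The pair \<open>(w, z)\<close> stands for the point \<open>p + (z / w) v\<close> of the line \<open>p + \<real> v\<close>, at infinity
  if \<open>w = 0\<close>. The two equations say that it lies on the quadric, and that with \<open>n\<close> normal to the
  quadric at this point, normalised as in \<open>quadric_normal\<close>, \<open>n \<bullet> v = \<delta>\<close>; so \<open>\<delta>\<close> tells the two
  intersection points apart.
\<close>

definition meets_at ::
    "real^'n \<Rightarrow> real \<Rightarrow> real \<Rightarrow> real^'n \<Rightarrow> real^'n \<Rightarrow> real \<Rightarrow> real \<Rightarrow> bool" where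
  "meets_at \<alpha> \<mu> \<delta> p v w z \<longleftrightarrow> (w \<noteq> 0 \<or> z \<noteq> 0) \<and>
     quadric_normal \<alpha> \<mu> (w *\<^sub>R p + z *\<^sub>R v) \<bullet> p = w - \<delta> * z \<and>
     quadric_normal \<alpha> \<mu> (w *\<^sub>R p + z *\<^sub>R v) \<bullet> v = \<delta> * w"

definition reflects :: "real^'n \<Rightarrow> real \<Rightarrow> real \<Rightarrow> 'n::finite dline \<Rightarrow> 'n dline \<Rightarrow> bool" where
  "reflects \<alpha> \<mu> \<delta> x y \<longleftrightarrow> (\<exists>p w z. p \<in> fst x \<and> meets_at \<alpha> \<mu> \<delta> p (snd x) w z \<and>
     y = mirror_line (quadric_normal \<alpha> \<mu> (w *\<^sub>R p + z *\<^sub>R snd x)) w x)"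

text \<open>A quarter of the discriminant of the equation for the intersection of line and quadric.\<close>

definition line_discr :: "real^'n \<Rightarrow> real \<Rightarrow> real^'n \<Rightarrow> real^'n::finite \<Rightarrow> real" where
  "line_discr \<alpha> \<mu> p v = (quadric_normal \<alpha> \<mu> p \<bullet> v)\<^sup>2 -
     (quadric_normal \<alpha> \<mu> v \<bullet> v) * (quadric_normal \<alpha> \<mu> p \<bullet> p - 1)"

text \<open>A vanishing normal would force \<open>w = 0\<close> by the two equations, leaving
  \<open>z v = 0\<close> with \<open>z\<close> and \<open>v\<close> both nonzero.\<close>

lemma meets_at_normal_nonzero:
  fixes v :: "real^'n::finite"
  assumes "regular_param \<alpha> \<mu>" "v \<noteq> 0" "meets_at \<alpha> \<mu> \<delta> p v w z"
  shows "quadric_normal \<alpha> \<mu> (w *\<^sub>R p + z *\<^sub>R v) \<noteq> 0"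
proof
  assume m: "quadric_normal \<alpha> \<mu> (w *\<^sub>R p + z *\<^sub>R v) = 0"
  then have q: "w *\<^sub>R p + z *\<^sub>R v = 0" by (rule quadric_normal_eq_0[OF assms(1)])
  have "w - \<delta> * z = 0" "\<delta> * w = 0"
    using assms(3) m unfolding meets_at_def by (metis inner_zero_left)+
  then have "w = 0" by auto
  then show False using q assms(2,3) by (simp add: meets_at_def)
qed

text \<open>Makes the choice of base point in \<open>reflects\<close> harmless: the coordinates
  change, but the vector that determines the normal does not.\<close>

lemma meets_at_shift:
  fixes p v :: "real^'n::finite"
  assumes "meets_at \<alpha> \<mu> \<delta> p v w z"
  shows "meets_at \<alpha> \<mu> \<delta> (p + t *\<^sub>R v) v w (z - t * w)"
    and "w *\<^sub>R (p + t *\<^sub>R v) + (z - t * w) *\<^sub>R v = w *\<^sub>R p + z *\<^sub>R v"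
proof -
  show q: "w *\<^sub>R (p + t *\<^sub>R v) + (z - t * w) *\<^sub>R v = w *\<^sub>R p + z *\<^sub>R v"
    by (simp add: algebra_simps)
  show "meets_at \<alpha> \<mu> \<delta> (p + t *\<^sub>R v) v w (z - t * w)"
    using assms unfolding meets_at_def q by (auto simp: inner_add_right algebra_simps)
qed

text \<open>Evaluating the symmetric form at the two points in both orders gives
  \<open>\<delta> (w z' - w' z) = 0\<close>. For \<open>\<delta> = 0\<close> this says nothing, and
  a line contained in the quadric meets it everywhere.\<close>

lemma meets_at_unique:
  fixes p v :: "real^'n::finite"
  assumes "meets_at \<alpha> \<mu> \<delta> p v w z" "meets_at \<alpha> \<mu> \<delta> p v w' z'" "\<delta> \<noteq> 0"
  obtains k where "k \<noteq> 0" "w' = k * w" "z' = k * z"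
proof -
  define q q' where "q = w *\<^sub>R p + z *\<^sub>R v" "q' = w' *\<^sub>R p + z' *\<^sub>R v"
  have "quadric_normal \<alpha> \<mu> q \<bullet> q' = quadric_normal \<alpha> \<mu> q' \<bullet> q"
    by (rule quadric_normal_self_adjoint)
  moreover have "quadric_normal \<alpha> \<mu> q \<bullet> q' = w' * (w - \<delta> * z) + z' * (\<delta> * w)"
    using assms(1) unfolding meets_at_def q_q'_def(1)[symmetric]
    by (simp add: q_q'_def(2) inner_add_right)
  moreover have "quadric_normal \<alpha> \<mu> q' \<bullet> q = w * (w' - \<delta> * z') + z * (\<delta> * w')"
    using assms(2) unfolding meets_at_def q_q'_def(2)[symmetric]
    by (simp add: q_q'_def(1) inner_add_right)
  ultimately have "w' * (w - \<delta> * z) + z' * (\<delta> * w) = w * (w' - \<delta> * z') + z * (\<delta> * w')"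
    by simp
  then have "\<delta> * (w * z' - w' * z) = 0" by (simp add: algebra_simps)
  then have wz: "w * z' = w' * z" using assms(3) by simp
  have nz: "w \<noteq> 0 \<or> z \<noteq> 0" "w' \<noteq> 0 \<or> z' \<noteq> 0" using assms(1,2) by (simp_all add: meets_at_def)
  show thesis
  proof (cases "w = 0")
    case True
    then have "w' = 0" using wz nz by auto
    then show thesis using that[of "z' / z"] True nz by simp
  next
    case False
    then have "w' \<noteq> 0" using wz nz by auto
    then show thesis using that[of "w' / w"] False wz by (simp add: field_simps)
  qed
qed

text \<open>The equations of \<open>meets_at\<close> are a homogeneous linear system in
  \<open>(w, z)\<close> with rows \<open>(D, B + \<delta>)\<close> and
  \<open>(B - \<delta>, A)\<close>. It has a nonzero solution iff its determinant
  \<open>\<delta>^2 - (B^2 - A D)\<close> vanishes.\<close>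

lemma line_discr_eq_iff:
  fixes p v :: "real^'n::finite"
  shows "line_discr \<alpha> \<mu> p v = \<delta>\<^sup>2 \<longleftrightarrow> (\<exists>w z. meets_at \<alpha> \<mu> \<delta> p v w z)"
proof -
  define A B D where "A = quadric_normal \<alpha> \<mu> v \<bullet> v" "B = quadric_normal \<alpha> \<mu> p \<bullet> v"
    "D = quadric_normal \<alpha> \<mu> p \<bullet> p - 1"
  have Bs: "quadric_normal \<alpha> \<mu> v \<bullet> p = B"
    by (simp add: A_B_D_def quadric_normal_self_adjoint)
  have meets: "meets_at \<alpha> \<mu> \<delta> p v w z \<longleftrightarrow> (w \<noteq> 0 \<or> z \<noteq> 0) \<and>
      w * D + z * (B + \<delta>) = 0 \<and> w * (B - \<delta>) + z * A = 0" for w z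
    unfolding meets_at_def using Bs
    by (auto simp: quadric_normal_linear inner_add_left A_B_D_def algebra_simps)
  have discr: "line_discr \<alpha> \<mu> p v = B * B - A * D"
    by (simp add: line_discr_def A_B_D_def power2_eq_square)
  show ?thesis
  proof
    assume "line_discr \<alpha> \<mu> p v = \<delta>\<^sup>2"
    then have d: "B * B - A * D = \<delta> * \<delta>" using discr by (simp add: power2_eq_square)
    \<comment> \<open>The kernel vector is read off the first row if that is nonzero, otherwise off
      the second; if both rows vanish, any nonzero vector serves.\<close>
    show "\<exists>w z. meets_at \<alpha> \<mu> \<delta> p v w z"
    proof (cases "B + \<delta> = 0 \<and> D = 0")
      case False
      then have "meets_at \<alpha> \<mu> \<delta> p v (B + \<delta>) (- D)"
        using d unfolding meets by (auto simp: algebra_simps)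
      then show ?thesis by blast
    next
      case True
      show ?thesis
      proof (cases "A = 0 \<and> B = \<delta>")
        case False
        then have "meets_at \<alpha> \<mu> \<delta> p v A (\<delta> - B)"
          using d True unfolding meets by (auto simp: algebra_simps)
        then show ?thesis by blast
      next
        case AB: True
        then have "meets_at \<alpha> \<mu> \<delta> p v 1 0" using True unfolding meets by auto
        then show ?thesis by blast
      qed
    qed
  next
    assume "\<exists>w z. meets_at \<alpha> \<mu> \<delta> p v w z"
    then obtain w z where nz: "w \<noteq> 0 \<or> z \<noteq> 0"
      and e: "w * D + z * (B + \<delta>) = 0" "w * (B - \<delta>) + z * A = 0" unfolding meets by blast
    have "w * (B * B - A * D - \<delta> * \<delta>) = 0" "z * (B * B - A * D - \<delta> * \<delta>) = 0"
      using e by algebra+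
    then show "line_discr \<alpha> \<mu> p v = \<delta>\<^sup>2" using nz unfolding discr by (auto simp: power2_eq_square)
  qed
qed

section \<open>Uniqueness, existence and inversion of reflections; invariance of the
  discriminant\<close>

lemma dline_point:
  assumes "is_dline L" "p \<in> fst L" "p' \<in> fst L"
  obtains t where "p' = p + t *\<^sub>R snd L"
  using assms dline_eq_range[OF assms(1,2)] by auto

lemma reflects_at_point:
  assumes "is_dline x" "reflects \<alpha> \<mu> \<delta> x y" "p \<in> fst x"
  obtains w z where "meets_at \<alpha> \<mu> \<delta> p (snd x) w z"
    "y = mirror_line (quadric_normal \<alpha> \<mu> (w *\<^sub>R p + z *\<^sub>R snd x)) w x"
proof -
  obtain p0 w z where p0: "p0 \<in> fst x" "meets_at \<alpha> \<mu> \<delta> p0 (snd x) w z"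
    "y = mirror_line (quadric_normal \<alpha> \<mu> (w *\<^sub>R p0 + z *\<^sub>R snd x)) w x"
    using assms(2) by (auto simp: reflects_def)
  obtain t where t: "p = p0 + t *\<^sub>R snd x" using dline_point[OF assms(1) p0(1) assms(3)] .
  show thesis using that[OF meets_at_shift(1)[OF p0(2), of t, folded t]]
    meets_at_shift(2)[OF p0(2), of t, folded t] p0(3) by simp
qed

lemma snd_nonzero: "is_dline x \<Longrightarrow> snd x \<noteq> 0"
  by (auto simp: is_dline_def)

lemma dline_has_point:
  assumes "is_dline x"
  obtains p where "p \<in> fst x"
  using assms that unfolding is_dline_def by (metis rangeI)

lemma is_dline_reflects:
  assumes "regular_param \<alpha> \<mu>" "is_dline x" "reflects \<alpha> \<mu> \<delta> x y"
  shows "is_dline y"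
  using assms meets_at_normal_nonzero[OF assms(1) snd_nonzero[OF assms(2)]]
  by (auto simp: reflects_def intro!: is_dline_mirror_line)

lemma reflects_unique:
  assumes "is_dline x" "reflects \<alpha> \<mu> \<delta> x y" "reflects \<alpha> \<mu> \<delta> x y'" "\<delta> \<noteq> 0"
  shows "y = y'"
proof -
  obtain p where p: "p \<in> fst x" using dline_has_point[OF assms(1)] .
  obtain w z where 1: "meets_at \<alpha> \<mu> \<delta> p (snd x) w z"
    "y = mirror_line (quadric_normal \<alpha> \<mu> (w *\<^sub>R p + z *\<^sub>R snd x)) w x"
    using reflects_at_point[OF assms(1,2) p] .
  obtain w' z' where 2: "meets_at \<alpha> \<mu> \<delta> p (snd x) w' z'"
    "y' = mirror_line (quadric_normal \<alpha> \<mu> (w' *\<^sub>R p + z' *\<^sub>R snd x)) w' x"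
    using reflects_at_point[OF assms(1,3) p] .
  obtain k where k: "k \<noteq> 0" "w' = k * w" "z' = k * z" using meets_at_unique[OF 1(1) 2(1) assms(4)] .
  have "w' *\<^sub>R p + z' *\<^sub>R snd x = k *\<^sub>R (w *\<^sub>R p + z *\<^sub>R snd x)" by (simp add: k algebra_simps)
  then show ?thesis
    using mirror_line_scaleR[OF k(1), of "quadric_normal \<alpha> \<mu> (w *\<^sub>R p + z *\<^sub>R snd x)" w x]
    by (simp add: 1(2) 2(2) k(2) quadric_normal_scaleR)
qed

text \<open>The equations of \<open>meets_at\<close> say
  \<open>m \<bullet> p - w = - \<delta> z\<close> and \<open>m \<bullet> v = \<delta> w\<close>. The
  resulting corrections cancel in \<open>w p + z v\<close>, so the point of reflection stays
  fixed.\<close>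

lemma mirror_meets_at:
  assumes "meets_at \<alpha> \<mu> \<delta> p v w z"
  defines "m \<equiv> quadric_normal \<alpha> \<mu> (w *\<^sub>R p + z *\<^sub>R v)"
  shows "mirror m w p = p + (2 * \<delta> / (m \<bullet> m) * z) *\<^sub>R m"
    and "mirror m 0 v = v - (2 * \<delta> / (m \<bullet> m) * w) *\<^sub>R m"
  using assms(1) by (simp_all add: meets_at_def m_def mirror_def)

text \<open>The same hyperplane reflects back, with the same coordinates \<open>(w, z)\<close>.
  Reflection negates \<open>m \<bullet> v\<close> and \<open>m \<bullet> p - w\<close>, hence
  \<open>- \<delta>\<close>.\<close>

lemma reflects_inverse:
  assumes "regular_param \<alpha> \<mu>" "is_dline x" "reflects \<alpha> \<mu> \<delta> x y"
  shows "reflects \<alpha> \<mu> (- \<delta>) y x"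
proof -
  obtain p w z where p: "p \<in> fst x" "meets_at \<alpha> \<mu> \<delta> p (snd x) w z"
    "y = mirror_line (quadric_normal \<alpha> \<mu> (w *\<^sub>R p + z *\<^sub>R snd x)) w x"
    using assms(3) by (auto simp: reflects_def)
  define m where "m = quadric_normal \<alpha> \<mu> (w *\<^sub>R p + z *\<^sub>R snd x)"
  have m0: "m \<noteq> 0"
    unfolding m_def by (rule meets_at_normal_nonzero[OF assms(1) snd_nonzero[OF assms(2)] p(2)])
  define p' v' where "p' = mirror m w p" "v' = mirror m 0 (snd x)"
  have p'v': "p' = p + (2 * \<delta> / (m \<bullet> m) * z) *\<^sub>R m" "v' = snd x - (2 * \<delta> / (m \<bullet> m) * w) *\<^sub>R m"
    unfolding p'_v'_def m_def by (rule mirror_meets_at[OF p(2)])+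
  have q: "w *\<^sub>R p' + z *\<^sub>R v' = w *\<^sub>R p + z *\<^sub>R snd x" unfolding p'v' by (simp add: algebra_simps)
  have "meets_at \<alpha> \<mu> (- \<delta>) p' v' w z"
    using p(2) m0 unfolding meets_at_def q unfolding m_def[symmetric] p'v'
    by (simp add: inner_add_right inner_diff_right)
  moreover have "p' \<in> fst y" "snd y = v'"
    using p by (auto simp: mirror_line_def p'_v'_def m_def)
  moreover have "x = mirror_line m w y" using mirror_line_mirror_line[OF m0, of w x] p(3) m_def by simp
  ultimately show ?thesis unfolding reflects_def using q m_def by metis
qed

lemma reflects_exists:
  assumes "is_dline x" "p \<in> fst x" "line_discr \<alpha> \<mu> p (snd x) = \<delta>\<^sup>2"
  obtains y where "reflects \<alpha> \<mu> \<delta> x y"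
  using assms line_discr_eq_iff unfolding reflects_def by blast

lemma line_discr_point:
  fixes x :: "'n::finite dline"
  assumes "is_dline x" "p \<in> fst x" "p' \<in> fst x"
  shows "line_discr \<alpha> \<mu> p' (snd x) = line_discr \<alpha> \<mu> p (snd x)"
proof -
  obtain t where t: "p' = p + t *\<^sub>R snd x" using dline_point[OF assms] .
  have "quadric_normal \<alpha> \<mu> (snd x) \<bullet> p = quadric_normal \<alpha> \<mu> p \<bullet> snd x"
    by (rule quadric_normal_self_adjoint)
  then show ?thesis
    by (simp add: t line_discr_def quadric_normal_linear inner_add_left inner_add_right
        power2_eq_square algebra_simps)
qed

text \<open>For \<open>\<nu> = \<mu>\<close> both sides equal \<open>\<delta>^2\<close>. Otherwise
  the resolvent identity expresses the form of \<open>\<nu>\<close> on the new line through its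
  values \<open>A\<close>, \<open>B\<close>, \<open>D\<close> on the old one.\<close>

lemma line_discr_reflects:
  fixes x y :: "'n::finite dline"
  assumes reg: "regular_param \<alpha> \<mu>" "regular_param \<alpha> \<nu>" and x: "is_dline x"
    and R: "reflects \<alpha> \<mu> \<delta> x y" and px: "p \<in> fst x" and py: "p' \<in> fst y"
  shows "line_discr \<alpha> \<nu> p' (snd y) = line_discr \<alpha> \<nu> p (snd x)"
proof (cases "\<nu> = \<mu>")
  case True
  have "line_discr \<alpha> \<mu> p (snd x) = \<delta>\<^sup>2"
    using reflects_at_point[OF x R px] line_discr_eq_iff by metis
  moreover have "line_discr \<alpha> \<mu> p' (snd y) = (- \<delta>)\<^sup>2"
    using reflects_at_point[OF is_dline_reflects[OF reg(1) x R] reflects_inverse[OF reg(1) x R] py]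
      line_discr_eq_iff by metis
  ultimately show ?thesis by (simp add: True)
next
  case False
  obtain w z where wz: "meets_at \<alpha> \<mu> \<delta> p (snd x) w z"
    "y = mirror_line (quadric_normal \<alpha> \<mu> (w *\<^sub>R p + z *\<^sub>R snd x)) w x"
    using reflects_at_point[OF x R px] .
  define v q where "v = snd x" "q = w *\<^sub>R p + z *\<^sub>R v"
  define m where "m = quadric_normal \<alpha> \<mu> q"
  have m0: "m \<noteq> 0"
    unfolding m_def v_q_def by (rule meets_at_normal_nonzero[OF reg(1) snd_nonzero[OF x] wz(1)])
  define k where "k = 2 * \<delta> / (m \<bullet> m)"
  have km: "k * (m \<bullet> m) = 2 * \<delta>" using m0 by (simp add: k_def)
  define P V where "P = mirror m w p" "V = mirror m 0 v"
  have PV: "P = p + (k * z) *\<^sub>R m" "V = v - (k * w) *\<^sub>R m"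
    unfolding P_V_def m_def v_q_def k_def using mirror_meets_at[OF wz(1)] by auto
  have Py: "P \<in> fst y" "snd y = V"
    using px by (auto simp: wz(2) mirror_line_def P_V_def m_def v_q_def)
  have mp: "m \<bullet> p = w - \<delta> * z" "m \<bullet> v = \<delta> * w"
    using wz(1) by (simp_all add: meets_at_def m_def v_q_def)
  define n where "n = quadric_normal \<alpha> \<nu>"
  define A B D where "A = n v \<bullet> v" "B = n p \<bullet> v" "D = n p \<bullet> p - 1"
  \<comment> \<open>Absorbs the division by \<open>\<nu> - \<mu>\<close> that the resolvent identity
    brings in.\<close>
  define h where "h = k / (\<nu> - \<mu>)"
  have hk: "k = h * (\<nu> - \<mu>)" using False by (simp add: h_def)
  have sym: "n a \<bullet> b = n b \<bullet> a" for a b unfolding n_def by (rule quadric_normal_self_adjoint)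
  have res: "(\<nu> - \<mu>) * (n m \<bullet> b) = n q \<bullet> b - m \<bullet> b" for b
    using quadric_normal_resolvent[OF reg, of q] unfolding n_def m_def
    by (metis inner_diff_left inner_scaleR_left)
  have nq: "n q \<bullet> b = w * (n p \<bullet> b) + z * (n v \<bullet> b)" for b
    by (simp add: n_def v_q_def quadric_normal_linear inner_add_left)
  have kp: "k * (n m \<bullet> p) = h * (w * D + z * (B + \<delta>))"
    unfolding hk mult.assoc res nq mp A_B_D_def sym[of v p] by (simp add: algebra_simps)
  have kv: "k * (n m \<bullet> v) = h * (w * (B - \<delta>) + z * A)"
    unfolding hk mult.assoc res nq mp A_B_D_def by (simp add: algebra_simps)
  have "k * (k * (n m \<bullet> m)) = k * (h * (n m \<bullet> q - m \<bullet> m))"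
    unfolding hk[THEN arg_cong, of "\<lambda>u. k * (u * _)"] mult.assoc res sym[of q m] by simp
  also have "\<dots> = h * (w * (k * (n m \<bullet> p)) + z * (k * (n m \<bullet> v)) - k * (m \<bullet> m))"
    by (simp add: v_q_def inner_add_right algebra_simps)
  also have "\<dots> = h * (w * (h * (w * D + z * (B + \<delta>))) + z * (h * (w * (B - \<delta>) + z * A)) - 2 * \<delta>)"
    unfolding kp kv km ..
  finally have kk: "k * (k * (n m \<bullet> m)) =
      h * (w * (h * (w * D + z * (B + \<delta>))) + z * (h * (w * (B - \<delta>) + z * A)) - 2 * \<delta>)" .
  \<comment> \<open>The homogenised equation of the quadric \<open>\<nu>\<close> at the point of
    reflection, that is \<open>n q \<bullet> q - w^2\<close>. In the three values computed next, all
    terms in \<open>\<delta>\<close> cancel.\<close>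
  define S where "S = w * w * D + 2 * w * z * B + z * z * A"
  have nPP: "n P \<bullet> P - 1 = D + 2 * h * z * (w * D + z * B) + h * h * z * z * S"
  proof -
    have "n P \<bullet> P - 1 = D + 2 * z * (k * (n m \<bullet> p)) + z * z * (k * (k * (n m \<bullet> m)))"
      using sym[of m p] unfolding PV n_def
      by (simp add: quadric_normal_linear inner_add_left inner_add_right A_B_D_def n_def algebra_simps)
    then show ?thesis unfolding kp kk S_def by (simp add: algebra_simps)
  qed
  have nPV: "n P \<bullet> V = B + h * z * (w * B + z * A) - h * w * (w * D + z * B) - h * h * w * z * S"
  proof -
    have "n P \<bullet> V = B + z * (k * (n m \<bullet> v)) - w * (k * (n m \<bullet> p)) - w * z * (k * (k * (n m \<bullet> m)))"
      using sym[of m p] unfolding PV n_def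
      by (simp add: quadric_normal_linear inner_add_left inner_diff_right A_B_D_def n_def algebra_simps)
    then show ?thesis unfolding kp kv kk S_def by (simp add: algebra_simps)
  qed
  have nVV: "n V \<bullet> V = A - 2 * h * w * (w * B + z * A) + h * h * w * w * S"
  proof -
    have "n V \<bullet> V = A - 2 * w * (k * (n m \<bullet> v)) + w * w * (k * (k * (n m \<bullet> m)))"
      using sym[of m v] unfolding PV n_def
      by (simp add: quadric_normal_linear inner_diff_left inner_diff_right A_B_D_def n_def algebra_simps)
    then show ?thesis unfolding kv kk S_def by (simp add: algebra_simps)
  qed
  \<comment> \<open>The symmetric matrix with rows \<open>(D, B)\<close> and \<open>(B, A)\<close>
    undergoes a congruence by a shear \<open>I + h (w, z)^T (z, -w)\<close>. The two vectors are
    orthogonal, so the shear has determinant 1 and the discriminant is unchanged.\<close>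
  have "(n P \<bullet> V)\<^sup>2 - (n V \<bullet> V) * (n P \<bullet> P - 1) = B\<^sup>2 - A * D"
    unfolding nPP nPV nVV S_def by algebra
  then have "line_discr \<alpha> \<nu> P V = line_discr \<alpha> \<nu> p v"
    by (simp add: line_discr_def A_B_D_def n_def)
  then show ?thesis
    using line_discr_point[OF is_dline_reflects[OF reg(1) x R] Py(1) py] Py(2) v_q_def(1) by simp
qed

text \<open>If \<open>A\<close> is nonzero, the equation for the intersection has its double root at
  \<open>- B / A\<close>. If \<open>A = 0\<close>, the discriminant is \<open>B^2\<close>, and its
  vanishing is tangency at infinity.\<close>

lemma tangent_iff_line_discr:
  fixes L :: "'n::finite dline"
  assumes L: "is_dline L" and p: "p \<in> fst L"
  shows "tangent_to_quadric \<alpha> \<mu> L \<longleftrightarrow> line_discr \<alpha> \<mu> p (snd L) = 0"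
proof
  assume "tangent_to_quadric \<alpha> \<mu> L"
  then consider P where "P \<in> fst L" "P \<in> confocal_quadric \<alpha> \<mu>" "quadric_normal \<alpha> \<mu> P \<bullet> snd L = 0"
    | "ideal_point_on \<alpha> \<mu> (snd L)" "\<forall>y\<in>fst L. quadric_normal \<alpha> \<mu> (snd L) \<bullet> y = 0"
    unfolding tangent_to_quadric_def by blast
  then show "line_discr \<alpha> \<mu> p (snd L) = 0"
  proof cases
    case 1
    then have "line_discr \<alpha> \<mu> P (snd L) = 0"
      by (simp add: line_discr_def inner_quadric_normal confocal_quadric_def)
    then show ?thesis using line_discr_point[OF L p 1(1)] by simp
  next
    case 2
    then show ?thesis using p quadric_normal_self_adjoint[of \<alpha> \<mu> p "snd L"]
      by (simp add: line_discr_def ideal_point_on_def inner_quadric_normal)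
  qed
next
  assume "line_discr \<alpha> \<mu> p (snd L) = 0"
  then have d: "(quadric_normal \<alpha> \<mu> p \<bullet> snd L)\<^sup>2 =
      (quadric_normal \<alpha> \<mu> (snd L) \<bullet> snd L) * (quadric_normal \<alpha> \<mu> p \<bullet> p - 1)"
    by (simp add: line_discr_def)
  have s: "quadric_normal \<alpha> \<mu> (snd L) \<bullet> p = quadric_normal \<alpha> \<mu> p \<bullet> snd L"
    by (rule quadric_normal_self_adjoint)
  have l: "fst L = range (\<lambda>t. p + t *\<^sub>R snd L)" by (rule dline_eq_range[OF L p])
  define A B where "A = quadric_normal \<alpha> \<mu> (snd L) \<bullet> snd L" "B = quadric_normal \<alpha> \<mu> p \<bullet> snd L"
  show "tangent_to_quadric \<alpha> \<mu> L"
  proof (cases "A = 0")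
    case True
    then have "B = 0" using d by (simp add: A_B_def)
    then have "\<forall>y\<in>fst L. quadric_normal \<alpha> \<mu> (snd L) \<bullet> y = 0"
      using True s by (auto simp: l A_B_def inner_add_right)
    moreover have "ideal_point_on \<alpha> \<mu> (snd L)"
      using True snd_nonzero[OF L] by (simp add: ideal_point_on_def A_B_def inner_quadric_normal)
    ultimately show ?thesis by (simp add: tangent_to_quadric_def)
  next
    case False
    define P where "P = p + (- (B / A)) *\<^sub>R snd L"
    have Pv: "quadric_normal \<alpha> \<mu> P \<bullet> snd L = 0"
      using False unfolding P_def quadric_normal_linear inner_add_left inner_scaleR_left
        A_B_def(1,2)[symmetric] by simp
    have "quadric_normal \<alpha> \<mu> P \<bullet> P = quadric_normal \<alpha> \<mu> P \<bullet> p"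
      using Pv by (subst (2) P_def) (simp only: inner_add_right inner_scaleR_right)
    also have "\<dots> = quadric_normal \<alpha> \<mu> p \<bullet> p - B\<^sup>2 / A"
      unfolding P_def quadric_normal_linear inner_add_left inner_scaleR_left s
        A_B_def(2)[symmetric] by (simp add: power2_eq_square)
    also have "\<dots> = 1" using d False by (simp add: A_B_def)
    finally have "P \<in> confocal_quadric \<alpha> \<mu>" by (simp add: inner_quadric_normal confocal_quadric_def)
    moreover have "P \<in> fst L" unfolding l P_def by blast
    ultimately show ?thesis using Pv unfolding tangent_to_quadric_def by blast
  qed
qed

lemma has_caustics_reflects:
  assumes "regular_param \<alpha> \<mu>" "\<forall>c\<in>C. regular_param \<alpha> c" "is_dline x"
    "reflects \<alpha> \<mu> \<delta> x y" "has_caustics \<alpha> C x"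
  shows "has_caustics \<alpha> C y"
proof -
  have y: "is_dline y" by (rule is_dline_reflects[OF assms(1,3,4)])
  obtain p where p: "p \<in> fst x" using dline_has_point[OF assms(3)] .
  obtain p' where p': "p' \<in> fst y" using dline_has_point[OF y] .
  show ?thesis
    using assms(2,5) line_discr_reflects[OF assms(1) _ assms(3,4) p p']
    by (simp add: has_caustics_def tangent_iff_line_discr[OF assms(3) p] tangent_iff_line_discr[OF y p'])
qed

lemma reflection_law_reflects:
  assumes x: "is_dline x" and y: "is_dline y" and R: "reflection_law \<alpha> \<mu> x y"
  obtains \<delta> where "reflects \<alpha> \<mu> \<delta> x y"
proof -
  consider P where "reflection_law_at \<alpha> \<mu> P x y" | "reflection_law_ideal \<alpha> \<mu> x y"
    using R by (auto simp: reflection_law_def)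
  then show thesis
  proof cases
    case 1
    then have P: "P \<in> confocal_quadric \<alpha> \<mu>" "P \<in> fst x"
      by (simp_all add: reflection_law_at_def Let_def)
    \<comment> \<open>The point of reflection itself serves as base point, hence the coordinates
      \<open>(1, 0)\<close>.\<close>
    have "meets_at \<alpha> \<mu> (quadric_normal \<alpha> \<mu> P \<bullet> snd x) P (snd x) 1 0"
      using P(1) by (simp add: meets_at_def inner_quadric_normal confocal_quadric_def)
    moreover have "y = mirror_line (quadric_normal \<alpha> \<mu> (1 *\<^sub>R P + 0 *\<^sub>R snd x)) 1 x"
      using 1 reflection_law_at_iff_mirror[OF x y P] by (simp add: mirror_line_def prod_eq_iff)
    ultimately show thesis using P(2) that unfolding reflects_def by blast
  next
    case 2
    obtain p where p: "p \<in> fst x" using dline_has_point[OF x] .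
    define n where "n = quadric_normal \<alpha> \<mu> (snd x)"
    have nv: "n \<bullet> snd x = 0"
      using 2 by (simp add: n_def reflection_law_ideal_def ideal_point_on_def inner_quadric_normal)
    \<comment> \<open>At infinity the second equation only says that \<open>v\<close> is asymptotic;
      the first one fixes \<open>\<delta>\<close>.\<close>
    have "meets_at \<alpha> \<mu> (- (n \<bullet> p)) p (snd x) 0 1"
      using nv by (simp add: meets_at_def n_def)
    moreover have "y = mirror_line (quadric_normal \<alpha> \<mu> (0 *\<^sub>R p + 1 *\<^sub>R snd x)) 0 x"
      using 2 nv by (simp add: mirror_line_def prod_eq_iff reflection_law_ideal_def n_def mirror_def)
    ultimately show thesis using p that unfolding reflects_def by blast
  qed
qed

text \<open>Dividing the coordinates by \<open>w\<close> gives an ordinary point of reflection;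
  \<open>w = 0\<close> is the ideal case.\<close>

lemma reflects_reflection_law:
  assumes reg: "regular_param \<alpha> \<mu>" and x: "is_dline x" and R: "reflects \<alpha> \<mu> \<delta> x y"
  shows "reflection_law \<alpha> \<mu> x y"
proof -
  have y: "is_dline y" by (rule is_dline_reflects[OF reg x R])
  obtain p w z where p: "p \<in> fst x" "meets_at \<alpha> \<mu> \<delta> p (snd x) w z"
    "y = mirror_line (quadric_normal \<alpha> \<mu> (w *\<^sub>R p + z *\<^sub>R snd x)) w x"
    using R by (auto simp: reflects_def)
  show ?thesis
  proof (cases "w = 0")
    case True
    then have z: "z \<noteq> 0" using p(2) by (simp add: meets_at_def)
    define n where "n = quadric_normal \<alpha> \<mu> (snd x)"
    have nv: "n \<bullet> snd x = 0"
      using p(2) True z by (simp add: meets_at_def n_def quadric_normal_linear)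
    have "y = mirror_line n 0 x"
      using p(3) True mirror_line_scaleR[OF z, of n 0 x] by (simp add: n_def quadric_normal_linear)
    then have "reflection_law_ideal \<alpha> \<mu> x y"
      using nv snd_nonzero[OF x]
      by (simp add: reflection_law_ideal_def ideal_point_on_def n_def inner_quadric_normal
          mirror_line_def mirror_def[of _ 0 "snd x"])
    then show ?thesis by (simp add: reflection_law_def)
  next
    case False
    define P where "P = p + (z / w) *\<^sub>R snd x"
    have wP: "w *\<^sub>R P = w *\<^sub>R p + z *\<^sub>R snd x" using False by (simp add: P_def algebra_simps)
    have nw: "w *\<^sub>R quadric_normal \<alpha> \<mu> P = quadric_normal \<alpha> \<mu> (w *\<^sub>R p + z *\<^sub>R snd x)"
      by (simp flip: wP add: quadric_normal_scaleR)
    have "w * (quadric_normal \<alpha> \<mu> P \<bullet> P) = quadric_normal \<alpha> \<mu> (w *\<^sub>R p + z *\<^sub>R snd x) \<bullet> P"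
      by (simp flip: nw)
    also have "\<dots> = w"
      using p(2) False by (simp add: P_def inner_add_right meets_at_def)
    finally have "P \<in> confocal_quadric \<alpha> \<mu>"
      using False by (simp add: inner_quadric_normal confocal_quadric_def)
    moreover have "P \<in> fst x" unfolding dline_eq_range[OF x p(1)] P_def by blast
    moreover have "y = mirror_line (quadric_normal \<alpha> \<mu> P) 1 x"
      using p(3) mirror_line_scaleR[OF False, of "quadric_normal \<alpha> \<mu> P" 1 x] nw by simp
    ultimately have "reflection_law_at \<alpha> \<mu> P x y"
      using reflection_law_at_iff_mirror[OF x y] by (simp add: mirror_line_def)
    then show ?thesis by (auto simp: reflection_law_def)
  qed
qed

subsection \<open>Commuting reflections\<close>

text \<open>
  How the reflection in \<open>\<mu>\<close> moves the point of intersection with \<open>\<nu>\<close>: the tangent hyperplane at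
  the new point lies in the pencil spanned by the two old tangent hyperplanes.
\<close>

lemma meets_at_mirror:
  fixes p v :: "real^'n::finite"
  assumes reg: "regular_param \<alpha> \<mu>" "regular_param \<alpha> \<nu>" and ne: "\<nu> \<noteq> \<mu>" and v: "v \<noteq> 0"
    and l: "meets_at \<alpha> \<nu> \<delta> p v w z" and m: "meets_at \<alpha> \<mu> \<delta>' p v w' z'"
  defines "L \<equiv> quadric_normal \<alpha> \<nu> (w *\<^sub>R p + z *\<^sub>R v)"
    and "M \<equiv> quadric_normal \<alpha> \<mu> (w' *\<^sub>R p + z' *\<^sub>R v)"
  defines "c \<equiv> 2 * \<delta>' * (w' * z - w * z') / ((\<nu> - \<mu>) * (M \<bullet> M))"
  shows "meets_at \<alpha> \<nu> \<delta> (mirror M w' p) (mirror M 0 v) (w + c * w') (z + c * z')"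
    and "quadric_normal \<alpha> \<nu> ((w + c * w') *\<^sub>R mirror M w' p + (z + c * z') *\<^sub>R mirror M 0 v)
      = L + c *\<^sub>R M"
    and "(\<nu> - \<mu>) * (M \<bullet> L) = - (\<delta> + \<delta>') * (w' * z - w * z')"
proof -
  define q q' \<omega> where "q = w *\<^sub>R p + z *\<^sub>R v" "q' = w' *\<^sub>R p + z' *\<^sub>R v" "\<omega> = w' * z - w * z'"
  note qdefs = q_q'_\<omega>_def
  have M0: "M \<noteq> 0" unfolding M_def by (rule meets_at_normal_nonzero[OF reg(1) v m])
  define k where "k = 2 * \<delta>' / (M \<bullet> M)"
  have kM: "k * (M \<bullet> M) = 2 * \<delta>'" using M0 by (simp add: k_def)
  \<comment> \<open>This choice of \<open>c\<close> lets the resolvent identity cancel the multiples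
    of \<open>quadric_normal \<alpha> \<nu> q'\<close>, so that the new normal stays in the span of
    \<open>L\<close> and \<open>M\<close>.\<close>
  have ck: "c * (\<nu> - \<mu>) = k * \<omega>" using ne by (simp add: c_def k_def qdefs)
  have P: "mirror M w' p = p + (k * z') *\<^sub>R M" and V: "mirror M 0 v = v - (k * w') *\<^sub>R M"
    using mirror_meets_at[OF m] by (simp_all add: M_def k_def)
  have Lp: "L \<bullet> p = w - \<delta> * z" "L \<bullet> v = \<delta> * w" using l by (simp_all add: L_def meets_at_def)
  have Mp: "M \<bullet> p = w' - \<delta>' * z'" "M \<bullet> v = \<delta>' * w'" using m by (simp_all add: M_def meets_at_def)
  have res: "(\<nu> - \<mu>) *\<^sub>R quadric_normal \<alpha> \<nu> M = quadric_normal \<alpha> \<nu> q' - M"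
    using quadric_normal_resolvent[OF reg, of q'] by (simp add: M_def qdefs)
  have "(\<nu> - \<mu>) * (M \<bullet> L) = (\<nu> - \<mu>) * (quadric_normal \<alpha> \<nu> M \<bullet> q)"
    unfolding L_def q_q'_\<omega>_def(1)[symmetric] using quadric_normal_self_adjoint[of \<alpha> \<nu> q M]
    by (simp add: inner_commute)
  also have "\<dots> = quadric_normal \<alpha> \<nu> q' \<bullet> q - M \<bullet> q"
    by (metis res inner_diff_left inner_scaleR_left)
  also have "quadric_normal \<alpha> \<nu> q' \<bullet> q = L \<bullet> q'"
    unfolding L_def q_q'_\<omega>_def(1)[symmetric] by (rule quadric_normal_self_adjoint)
  also have "L \<bullet> q' - M \<bullet> q = - (\<delta> + \<delta>') * \<omega>"
    by (simp add: qdefs inner_add_right Lp Mp) (simp add: algebra_simps)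
  finally show pencil: "(\<nu> - \<mu>) * (M \<bullet> L) = - (\<delta> + \<delta>') * (w' * z - w * z')" by (simp add: qdefs)
  have "(\<nu> - \<mu>) * (k * (M \<bullet> L)) = (\<nu> - \<mu>) * (- c * (\<delta> + \<delta>'))"
    using pencil ck unfolding q_q'_\<omega>_def(3)[symmetric] by algebra
  then have kpencil: "k * (M \<bullet> L) = - c * (\<delta> + \<delta>')"
    using ne by (metis mult_left_cancel right_minus_eq)
  have "(w + c * w') *\<^sub>R mirror M w' p + (z + c * z') *\<^sub>R mirror M 0 v
      = q + c *\<^sub>R q' - (k * \<omega>) *\<^sub>R M"
    unfolding P V qdefs by (simp add: algebra_simps)
  then have "quadric_normal \<alpha> \<nu> ((w + c * w') *\<^sub>R mirror M w' p + (z + c * z') *\<^sub>R mirror M 0 v)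
      = L + c *\<^sub>R quadric_normal \<alpha> \<nu> q' - (k * \<omega>) *\<^sub>R quadric_normal \<alpha> \<nu> M"
    by (simp add: quadric_normal_linear L_def qdefs)
  also have "(k * \<omega>) *\<^sub>R quadric_normal \<alpha> \<nu> M = c *\<^sub>R (quadric_normal \<alpha> \<nu> q' - M)"
    unfolding ck[symmetric] res[symmetric] by simp
  finally show N: "quadric_normal \<alpha> \<nu>
      ((w + c * w') *\<^sub>R mirror M w' p + (z + c * z') *\<^sub>R mirror M 0 v) = L + c *\<^sub>R M"
    by (simp add: algebra_simps)
  have "(L + c *\<^sub>R M) \<bullet> mirror M w' p = w - \<delta> * z + z' * (k * (M \<bullet> L)) + c * (w' - \<delta>' * z') +
      c * z' * (k * (M \<bullet> M))"
    unfolding P by (simp add: inner_add_left inner_add_right Lp Mp inner_commute[of L M] algebra_simps)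
  also have "\<dots> = w + c * w' - \<delta> * (z + c * z')"
    unfolding kpencil kM by (simp add: algebra_simps)
  finally have e1: "(L + c *\<^sub>R M) \<bullet> mirror M w' p = w + c * w' - \<delta> * (z + c * z')" .
  have "(L + c *\<^sub>R M) \<bullet> mirror M 0 v = \<delta> * w - w' * (k * (M \<bullet> L)) + c * (\<delta>' * w') -
      c * w' * (k * (M \<bullet> M))"
    unfolding V by (simp add: inner_add_left inner_diff_right Lp Mp inner_commute[of L M] algebra_simps)
  also have "\<dots> = \<delta> * (w + c * w')"
    unfolding kpencil kM by (simp add: algebra_simps)
  finally have e2: "(L + c *\<^sub>R M) \<bullet> mirror M 0 v = \<delta> * (w + c * w')" .
  have "w + c * w' \<noteq> 0 \<or> z + c * z' \<noteq> 0"
  proof (rule ccontr)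
    assume "\<not> ?thesis"
    \<comment> \<open>The old coordinates would be proportional to \<open>(w', z')\<close>, which
      makes \<open>\<omega>\<close>, then \<open>c\<close>, then \<open>w\<close> and
      \<open>z\<close> vanish.\<close>
    then have wz: "w = - c * w'" "z = - c * z'" by (simp_all add: add_eq_0_iff)
    then have "\<omega> = 0" by (simp add: qdefs)
    then have "c = 0" by (simp add: c_def qdefs)
    then show False using wz l by (simp add: meets_at_def)
  qed
  then show "meets_at \<alpha> \<nu> \<delta> (mirror M w' p) (mirror M 0 v) (w + c * w') (z + c * z')"
    unfolding meets_at_def N using e1 e2 by simp
qed

text \<open>\<open>meets_at_mirror\<close> is applied twice, with the quadrics exchanged, to find
  the second hyperplane in either order; \<open>mirror_pencil\<close> then identifies the two
  compositions, and uniqueness identifies the result with \<open>y'\<close>.\<close>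

lemma reflects_commute_distinct:
  fixes x y x' y' :: "'n::finite dline"
  assumes reg: "regular_param \<alpha> \<mu>" "regular_param \<alpha> \<nu>" and ne: "\<nu> \<noteq> \<mu>" and x: "is_dline x"
    and xx': "reflects \<alpha> \<nu> \<delta> x x'" and xy: "reflects \<alpha> \<mu> \<delta>' x y" and yy': "reflects \<alpha> \<nu> \<delta> y y'"
    and \<delta>: "\<delta> \<noteq> 0"
  shows "reflects \<alpha> \<mu> \<delta>' x' y'"
proof -
  define v where "v = snd x"
  have v: "v \<noteq> 0" unfolding v_def by (rule snd_nonzero[OF x])
  obtain p where p: "p \<in> fst x" using dline_has_point[OF x] .
  obtain w z where l: "meets_at \<alpha> \<nu> \<delta> p v w z"
    "x' = mirror_line (quadric_normal \<alpha> \<nu> (w *\<^sub>R p + z *\<^sub>R v)) w x"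
    unfolding v_def using reflects_at_point[OF x xx' p] .
  obtain w' z' where m: "meets_at \<alpha> \<mu> \<delta>' p v w' z'"
    "y = mirror_line (quadric_normal \<alpha> \<mu> (w' *\<^sub>R p + z' *\<^sub>R v)) w' x"
    unfolding v_def using reflects_at_point[OF x xy p] .
  define L M where "L = quadric_normal \<alpha> \<nu> (w *\<^sub>R p + z *\<^sub>R v)"
    "M = quadric_normal \<alpha> \<mu> (w' *\<^sub>R p + z' *\<^sub>R v)"
  note LM = L_M_def
  define c d where "c = 2 * \<delta>' * (w' * z - w * z') / ((\<nu> - \<mu>) * (M \<bullet> M))"
    "d = 2 * \<delta> * (w * z' - w' * z) / ((\<mu> - \<nu>) * (L \<bullet> L))"
  note cd = c_d_def
  have LM0: "L \<noteq> 0" "M \<noteq> 0"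
    unfolding LM by (rule meets_at_normal_nonzero[OF reg(2) v l(1)] meets_at_normal_nonzero[OF reg(1) v m(1)])+
  note A = meets_at_mirror[OF reg ne v l(1) m(1), folded LM, folded cd]
  note B = meets_at_mirror[OF reg(2,1) ne[symmetric] v m(1) l(1), folded LM, folded cd]
  have V: "mirror M 0 v \<noteq> 0" using norm_mirror[OF LM0(2), of v] v by auto
  have L'0: "L + c *\<^sub>R M \<noteq> 0" using meets_at_normal_nonzero[OF reg(2) V A(1)] A(2) by simp
  \<comment> \<open>Adding this equation and the next gives
    \<open>2 (\<delta> + \<delta>') (w' z - w z')\<close>, which \<open>A(3)\<close> turns into the
    pencil condition.\<close>
  have "(\<nu> - \<mu>) * (c * (M \<bullet> M)) = 2 * \<delta>' * (w' * z - w * z')"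
    using ne LM0(2) by (simp add: cd)
  moreover have "(\<nu> - \<mu>) * (d * (L \<bullet> L)) = 2 * \<delta> * (w' * z - w * z')"
    using ne LM0(1) by (simp add: cd divide_simps) (simp add: algebra_simps)
  ultimately have "(\<nu> - \<mu>) * (2 * (M \<bullet> L)) = (\<nu> - \<mu>) * (- c * (M \<bullet> M) - d * (L \<bullet> L))"
    using A(3) by algebra
  then have pencil: "2 * (M \<bullet> L) = - c * (M \<bullet> M) - d * (L \<bullet> L)" using ne by simp
  have x'e: "x' = mirror_line L w x" and ye: "y = mirror_line M w' x" using l(2) m(2) LM by simp_all
  \<comment> \<open>The pencil identity is needed with offsets \<open>w\<close>, \<open>w'\<close>
    for points and with offsets 0 for directions.\<close>
  have "mirror_line (L + c *\<^sub>R M) (w + c * w') y = mirror_line (M + d *\<^sub>R L) (w' + d * w) x'"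
    unfolding x'e ye mirror_line_def
    using mirror_pencil[OF pencil LM0(2,1) L'0, of w w'] mirror_pencil[OF pencil LM0(2,1) L'0, of 0 0]
    by (simp add: image_image)
  moreover have "reflects \<alpha> \<nu> \<delta> y (mirror_line (L + c *\<^sub>R M) (w + c * w') y)"
    unfolding reflects_def
    by (rule exI[of _ "mirror M w' p"], rule exI[of _ "w + c * w'"], rule exI[of _ "z + c * z'"])
      (use A p in \<open>simp add: ye mirror_line_def v_def\<close>)
  then have "y' = mirror_line (L + c *\<^sub>R M) (w + c * w') y"
    using reflects_unique[OF is_dline_reflects[OF reg(1) x xy] yy' _ \<delta>] by simp
  ultimately have "y' = mirror_line (M + d *\<^sub>R L) (w' + d * w) x'" by simp
  then show ?thesis unfolding reflects_def
    by (intro exI[of _ "mirror L w p"] exI[of _ "w' + d * w"] exI[of _ "z' + d * z"])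
      (use B p in \<open>simp add: x'e mirror_line_def v_def\<close>)
qed

text \<open>On a single quadric the common discriminant gives \<open>\<delta>' = \<delta>\<close> or
  \<open>\<delta>' = - \<delta>\<close>, so the two reflections are equal or inverse to each
  other.\<close>

lemma reflects_commute:
  fixes x y x' y' :: "'n::finite dline"
  assumes reg: "regular_param \<alpha> \<mu>" "regular_param \<alpha> \<nu>" and x: "is_dline x"
    and xx': "reflects \<alpha> \<nu> \<delta> x x'" and xy: "reflects \<alpha> \<mu> \<delta>' x y" and yy': "reflects \<alpha> \<nu> \<delta> y y'"
    and \<delta>: "\<delta> \<noteq> 0"
  shows "reflects \<alpha> \<mu> \<delta>' x' y'"
proof (cases "\<nu> = \<mu>")
  case True
  obtain p where p: "p \<in> fst x" using dline_has_point[OF x] .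
  have "line_discr \<alpha> \<mu> p (snd x) = \<delta>\<^sup>2" "line_discr \<alpha> \<mu> p (snd x) = \<delta>'\<^sup>2"
    using reflects_at_point[OF x xx' p] reflects_at_point[OF x xy p] line_discr_eq_iff True by metis+
  then consider "\<delta>' = \<delta>" | "\<delta>' = - \<delta>" by (metis power2_eq_iff)
  then show ?thesis
  proof cases
    case 1
    then have "y = x'" using reflects_unique[OF x xy] xx' True \<delta> by simp
    then show ?thesis using yy' 1 True by simp
  next
    case 2
    have y: "is_dline y" by (rule is_dline_reflects[OF reg(1) x xy])
    have "reflects \<alpha> \<mu> \<delta> y x" using reflects_inverse[OF reg(1) x xy] 2 by simp
    then have "y' = x" using reflects_unique[OF y yy'] True \<delta> by simp
    then show ?thesis using reflects_inverse[OF reg(2) x xx'] 2 True by simp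
  qed
next
  case False
  then show ?thesis using reflects_commute_distinct[OF reg False x xx' xy yy' \<delta>] by simp
qed

subsection \<open>Connecting trajectories and the billiard\<close>

lemma connects_via_Nil:
  "connects_via \<alpha> C [] x y \<longleftrightarrow> x = y \<and> is_dline x \<and> has_caustics \<alpha> C x"
proof
  show "x = y \<and> is_dline x \<and> has_caustics \<alpha> C x \<Longrightarrow> connects_via \<alpha> C [] x y"
    unfolding connects_via_def connecting_trajectory_def by (intro exI[of _ "[x]"]) auto
qed (auto simp: connects_via_def connecting_trajectory_def length_Suc_conv)

lemma connects_via_Cons:
  "connects_via \<alpha> C (\<mu> # \<Lambda>) x y \<longleftrightarrow> is_dline x \<and> has_caustics \<alpha> C x \<and> regular_param \<alpha> \<mu> \<and>
     (\<exists>u. reflection_law \<alpha> \<mu> x u \<and> connects_via \<alpha> C \<Lambda> u y)"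
proof
  assume "connects_via \<alpha> C (\<mu> # \<Lambda>) x y"
  then obtain Ls where Ls: "connecting_trajectory \<alpha> C (\<mu> # \<Lambda>) Ls x y"
    by (auto simp: connects_via_def)
  then obtain l Ls' where l: "Ls = l # Ls'" by (cases Ls) (auto simp: connecting_trajectory_def)
  have "reflection_law \<alpha> \<mu> x (Ls' ! 0)"
    using Ls by (auto simp: connecting_trajectory_def l dest: spec[of _ "0::nat"])
  moreover have "\<forall>k<length \<Lambda>. reflection_law \<alpha> (\<Lambda> ! k) (Ls' ! k) (Ls' ! (k + 1))"
    using Ls by (force simp: connecting_trajectory_def l)
  then have "connecting_trajectory \<alpha> C \<Lambda> Ls' (Ls' ! 0) y"
    using Ls by (simp add: connecting_trajectory_def l)
  moreover have "is_dline x \<and> has_caustics \<alpha> C x \<and> regular_param \<alpha> \<mu>"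
    using Ls by (auto simp: connecting_trajectory_def l)
  ultimately show "is_dline x \<and> has_caustics \<alpha> C x \<and> regular_param \<alpha> \<mu> \<and>
     (\<exists>u. reflection_law \<alpha> \<mu> x u \<and> connects_via \<alpha> C \<Lambda> u y)"
    unfolding connects_via_def by blast
next
  assume *: "is_dline x \<and> has_caustics \<alpha> C x \<and> regular_param \<alpha> \<mu> \<and>
     (\<exists>u. reflection_law \<alpha> \<mu> x u \<and> connects_via \<alpha> C \<Lambda> u y)"
  then obtain u Ls where u: "reflection_law \<alpha> \<mu> x u" "connecting_trajectory \<alpha> C \<Lambda> Ls u y"
    by (auto simp: connects_via_def)
  have "connecting_trajectory \<alpha> C (\<mu> # \<Lambda>) (x # Ls) x y"
    using * u by (auto simp: connecting_trajectory_def nth_Cons split: nat.split)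
  then show "connects_via \<alpha> C (\<mu> # \<Lambda>) x y" by (auto simp: connects_via_def)
qed

lemma connects_via_is_dline:
  assumes "connects_via \<alpha> C \<Lambda> x y"
  shows "is_dline x"
  using assms by (cases \<Lambda>) (auto simp: connects_via_Nil connects_via_Cons)

lemma line_discr_connects_via:
  fixes x y :: "'n::finite dline"
  assumes "connects_via \<alpha> C \<Lambda> x y" "regular_param \<alpha> \<nu>" "p \<in> fst x" "p' \<in> fst y"
  shows "line_discr \<alpha> \<nu> p (snd x) = line_discr \<alpha> \<nu> p' (snd y)"
  using assms(1,3)
proof (induction \<Lambda> arbitrary: x p)
  case Nil
  then have "x = y" "is_dline x" by (auto simp: connects_via_Nil)
  then show ?case using line_discr_point[of x p' p] Nil.prems(2) assms(4) by simp
next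
  case (Cons \<mu> \<Lambda>)
  then obtain u where u: "reflection_law \<alpha> \<mu> x u" "connects_via \<alpha> C \<Lambda> u y"
    and x: "is_dline x" and reg: "regular_param \<alpha> \<mu>" by (auto simp: connects_via_Cons)
  have ud: "is_dline u" by (rule connects_via_is_dline[OF u(2)])
  obtain q where q: "q \<in> fst u" using dline_has_point[OF ud] .
  obtain \<delta> where "reflects \<alpha> \<mu> \<delta> x u" using reflection_law_reflects[OF x ud u(1)] .
  then have "line_discr \<alpha> \<nu> q (snd u) = line_discr \<alpha> \<nu> p (snd x)"
    by (rule line_discr_reflects[OF reg assms(2) x _ Cons.prems(2) q])
  then show ?case using Cons.IH[OF u(2) q] by simp
qed

text \<open>A ladder of commuting squares: every line of the trajectory is reflected on
  \<open>\<nu>\<close> with the same \<open>\<delta>\<close>, and uniqueness makes the last image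
  equal to \<open>y'\<close>.\<close>

lemma connects_via_reflects:
  fixes x y x' y' :: "'n::finite dline"
  assumes "connects_via \<alpha> C \<Lambda> x y" "reflects \<alpha> \<nu> \<delta> x x'" and yy': "reflects \<alpha> \<nu> \<delta> y y'"
    and \<delta>: "\<delta> \<noteq> 0" and reg: "regular_param \<alpha> \<nu>" and C: "\<forall>c\<in>C. regular_param \<alpha> c"
  shows "connects_via \<alpha> C \<Lambda> x' y'"
  using assms(1,2)
proof (induction \<Lambda> arbitrary: x x')
  case Nil
  then have x: "x = y" "is_dline x" "has_caustics \<alpha> C x" by (auto simp: connects_via_Nil)
  then have "x' = y'" using reflects_unique[OF x(2) Nil.prems(2) _ \<delta>] yy' by simp
  then show ?case
    using is_dline_reflects[OF reg x(2) Nil.prems(2)] has_caustics_reflects[OF reg C x(2) Nil.prems(2) x(3)]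
    by (simp add: connects_via_Nil)
next
  case (Cons \<mu> \<Lambda>)
  then obtain u where u: "reflection_law \<alpha> \<mu> x u" "connects_via \<alpha> C \<Lambda> u y"
    and x: "is_dline x" "has_caustics \<alpha> C x" and reg\<mu>: "regular_param \<alpha> \<mu>"
    by (auto simp: connects_via_Cons)
  have ud: "is_dline u" by (rule connects_via_is_dline[OF u(2)])
  obtain \<delta>' where xu: "reflects \<alpha> \<mu> \<delta>' x u" using reflection_law_reflects[OF x(1) ud u(1)] .
  obtain p where p: "p \<in> fst x" using dline_has_point[OF x(1)] .
  obtain q where q: "q \<in> fst u" using dline_has_point[OF ud] .
  \<comment> \<open>Invariance of the discriminant provides the next rung: \<open>u\<close> also has
    a reflection on \<open>\<nu>\<close> with this \<open>\<delta>\<close>.\<close>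
  have "line_discr \<alpha> \<nu> p (snd x) = \<delta>\<^sup>2"
    using reflects_at_point[OF x(1) Cons.prems(2) p] line_discr_eq_iff by metis
  then have "line_discr \<alpha> \<nu> q (snd u) = \<delta>\<^sup>2"
    using line_discr_reflects[OF reg\<mu> reg x(1) xu p q] by simp
  then obtain u' where u': "reflects \<alpha> \<nu> \<delta> u u'" using reflects_exists[OF ud q] by blast
  have "reflects \<alpha> \<mu> \<delta>' x' u'"
    by (rule reflects_commute[OF reg\<mu> reg x(1) Cons.prems(2) xu u' \<delta>])
  moreover have x': "is_dline x'" by (rule is_dline_reflects[OF reg x(1) Cons.prems(2)])
  ultimately have "reflection_law \<alpha> \<mu> x' u'" using reflects_reflection_law[OF reg\<mu>] by blast
  moreover have "has_caustics \<alpha> C x'" by (rule has_caustics_reflects[OF reg C x(1) Cons.prems(2) x(2)])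
  ultimately show ?case
    using Cons.IH[OF u(2) u'] x' reg\<mu> unfolding connects_via_Cons by blast
qed

section \<open>The billiard step on the ellipsoid\<close>

lemma is_dline_through:
  assumes "P \<noteq> Q"
  shows "is_dline (dline_through P Q)"
proof -
  have "affine hull {P, Q} = range (\<lambda>t. P + t *\<^sub>R sgn (Q - P))"
  proof (intro equalityI subsetI)
    fix y assume "y \<in> affine hull {P, Q}"
    then obtain u v where "y = u *\<^sub>R P + v *\<^sub>R Q" "u + v = 1" by (auto simp: affine_hull_2)
    then have "y = P + v *\<^sub>R (Q - P)" by (simp add: algebra_simps flip: scaleR_add_left)
    also have "\<dots> = P + (v * norm (Q - P)) *\<^sub>R sgn (Q - P)" using assms by (simp add: sgn_div_norm)
    finally show "y \<in> range (\<lambda>t. P + t *\<^sub>R sgn (Q - P))" by blast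
  next
    fix y assume "y \<in> range (\<lambda>t. P + t *\<^sub>R sgn (Q - P))"
    then obtain t where "y = P + (t / norm (Q - P)) *\<^sub>R (Q - P)"
      by (auto simp: sgn_div_norm divide_inverse)
    then have "y = (1 - t / norm (Q - P)) *\<^sub>R P + (t / norm (Q - P)) *\<^sub>R Q"
      by (simp add: algebra_simps)
    then show "y \<in> affine hull {P, Q}" unfolding affine_hull_2 by (smt (verit) mem_Collect_eq)
  qed
  then show ?thesis using assms by (auto simp: is_dline_def dline_through_def norm_sgn)
qed

text \<open>A chord leaves the ellipsoid at its endpoint: as \<open>X\<close> and \<open>Y\<close>
  both lie on it, \<open>n \<bullet> (Y - X)\<close> is half the value of the positive definite form
  at \<open>Y - X\<close>.\<close>

lemma billiard_within_reflects:
  fixes L :: "int \<Rightarrow> 'n::finite dline"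
  assumes bil: "billiard_within \<alpha> \<epsilon> L" and ell: "\<forall>i. \<epsilon> < \<alpha> $ i"
  obtains \<delta> where "\<delta> > 0" "reflects \<alpha> \<epsilon> \<delta> (L m) (L (m + 1))" "is_dline (L m)"
proof -
  obtain P where P: "\<And>m. P m \<in> confocal_quadric \<alpha> \<epsilon>" "\<And>m. P m \<noteq> P (m + 1)"
      "\<And>m. L m = dline_through (P m) (P (m + 1))"
      "\<And>m. reflection_law_at \<alpha> \<epsilon> (P (m + 1)) (L m) (L (m + 1))"
    using bil unfolding billiard_within_def by blast
  have d: "is_dline (L m)" for m using is_dline_through P(2,3) by metis
  define X Y where "X = P m" "Y = P (m + 1)"
  have XY: "X \<noteq> Y" using P(2) by (simp add: X_Y_def)
  define n where "n = quadric_normal \<alpha> \<epsilon> Y"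
  define \<delta> where "\<delta> = n \<bullet> snd (L m)"
  have on: "quadric_normal \<alpha> \<epsilon> X \<bullet> X = 1" "n \<bullet> Y = 1"
    using P(1) by (simp_all add: X_Y_def n_def inner_quadric_normal confocal_quadric_def)
  have "quadric_normal \<alpha> \<epsilon> (Y - X) \<bullet> (Y - X) > 0"
  proof -
    obtain i where "(Y - X) $ i \<noteq> 0" using XY by (metis vec_eq_iff right_minus_eq vector_minus_component)
    then show ?thesis unfolding inner_quadric_normal
      using ell by (intro sum_pos2[of _ i]) (auto intro: divide_pos_pos simp: less_imp_le)
  qed
  also have "quadric_normal \<alpha> \<epsilon> (Y - X) \<bullet> (Y - X) = 2 * (n \<bullet> (Y - X))"
    using on quadric_normal_self_adjoint[of \<alpha> \<epsilon> X Y]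
    by (simp add: n_def quadric_normal_linear inner_diff_left inner_diff_right)
  finally have "\<delta> > 0"
    using XY by (simp add: \<delta>_def P(3) dline_through_def sgn_div_norm flip: X_Y_def)
  have Y: "Y \<in> confocal_quadric \<alpha> \<epsilon>" "Y \<in> fst (L m)"
    using P(1) P(4)[of m] by (simp_all add: X_Y_def reflection_law_at_def Let_def)
  have "L (m + 1) = mirror_line n 1 (L m)"
    using reflection_law_at_iff_mirror[OF d d Y] P(4)[of m]
    by (simp add: n_def X_Y_def mirror_line_def prod_eq_iff)
  moreover have "meets_at \<alpha> \<epsilon> \<delta> Y (snd (L m)) 1 0"
    using on by (simp add: meets_at_def \<delta>_def n_def)
  ultimately have "reflects \<alpha> \<epsilon> \<delta> (L m) (L (m + 1))"
    unfolding reflects_def n_def using Y(2)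
    by (intro exI[of _ Y] exI[of _ 1] exI[of _ 0]) simp
  then show thesis using that \<open>\<delta> > 0\<close> d by blast
qed

text \<open>If the lines are connected, their discriminants agree, so
  \<open>\<delta>' = \<delta>\<close> because both are positive. The backward direction uses the
  inverse step, with \<open>- \<delta>\<close>.\<close>

lemma connects_via_billiard_step:
  fixes a b :: "int \<Rightarrow> 'n::finite dline"
  assumes a: "billiard_within \<alpha> \<epsilon> a" and b: "billiard_within \<alpha> \<epsilon> b" and ell: "\<forall>i. \<epsilon> < \<alpha> $ i"
    and C: "\<forall>c\<in>C. regular_param \<alpha> c"
  shows "connects_via \<alpha> C \<Lambda> (a (m + 1)) (b (m + 1)) \<longleftrightarrow> connects_via \<alpha> C \<Lambda> (a m) (b m)"
proof -
  have reg: "regular_param \<alpha> \<epsilon>"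
    unfolding regular_param_def using ell by (metis less_irrefl)
  obtain \<delta> where \<delta>: "\<delta> > 0" "reflects \<alpha> \<epsilon> \<delta> (a m) (a (m + 1))" and am: "is_dline (a m)"
    using billiard_within_reflects[OF a ell] .
  obtain \<delta>' where \<delta>': "\<delta>' > 0" "reflects \<alpha> \<epsilon> \<delta>' (b m) (b (m + 1))" and bm: "is_dline (b m)"
    using billiard_within_reflects[OF b ell] .
  have a': "is_dline (a (m + 1))" "reflects \<alpha> \<epsilon> (- \<delta>) (a (m + 1)) (a m)"
    using is_dline_reflects[OF reg am \<delta>(2)] reflects_inverse[OF reg am \<delta>(2)] .
  have b': "is_dline (b (m + 1))" "reflects \<alpha> \<epsilon> (- \<delta>') (b (m + 1)) (b m)"
    using is_dline_reflects[OF reg bm \<delta>'(2)] reflects_inverse[OF reg bm \<delta>'(2)] .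
  have same: "\<sigma>\<^sup>2 = \<sigma>'\<^sup>2" if xy: "is_dline x" "is_dline y" "reflects \<alpha> \<epsilon> \<sigma> x x'" "reflects \<alpha> \<epsilon> \<sigma>' y y'"
    "connects_via \<alpha> C \<Lambda> x y" for x y x' y' :: "'n dline" and \<sigma> \<sigma>'
  proof -
    obtain p where p: "p \<in> fst x" using dline_has_point[OF xy(1)] .
    obtain q where q: "q \<in> fst y" using dline_has_point[OF xy(2)] .
    have "line_discr \<alpha> \<epsilon> p (snd x) = \<sigma>\<^sup>2" "line_discr \<alpha> \<epsilon> q (snd y) = \<sigma>'\<^sup>2"
      using reflects_at_point[OF xy(1,3) p] reflects_at_point[OF xy(2,4) q] line_discr_eq_iff
      by metis+
    then show ?thesis using line_discr_connects_via[OF xy(5) reg p q] by simp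
  qed
  show ?thesis
  proof
    assume "connects_via \<alpha> C \<Lambda> (a m) (b m)"
    moreover from this have "\<delta>' = \<delta>"
      using same[OF am bm \<delta>(2) \<delta>'(2)] \<delta>(1) \<delta>'(1) by (simp add: power2_eq_iff)
    ultimately show "connects_via \<alpha> C \<Lambda> (a (m + 1)) (b (m + 1))"
      using connects_via_reflects[OF _ \<delta>(2) _ _ reg C] \<delta>(1) \<delta>'(2) by simp
  next
    assume "connects_via \<alpha> C \<Lambda> (a (m + 1)) (b (m + 1))"
    moreover from this have "\<delta>' = \<delta>"
      using same[OF a'(1) b'(1) a'(2) b'(2)] \<delta>(1) \<delta>'(1) by (simp add: power2_eq_iff)
    ultimately show "connects_via \<alpha> C \<Lambda> (a m) (b m)"
      using connects_via_reflects[OF _ a'(2) _ _ reg C] \<delta>(1) b'(2) by simp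
  qed
qed

theorem theorem19:
  fixes \<alpha> :: "real^'n::finite" and \<epsilon> :: real and C :: "real set"
    and a b :: "int \<Rightarrow> 'n dline" and s :: int and \<Lambda> :: "real list"
  assumes distinct_params: "inj (\<lambda>i. \<alpha> $ i)"
    and ellipsoid: "\<forall>i. \<epsilon> < \<alpha> $ i"
    and caustics: "caustic_params \<alpha> C"
    and traj_a: "billiard_within \<alpha> \<epsilon> a"
    and traj_b: "billiard_within \<alpha> \<epsilon> b"
    and shared_caustics: "\<forall>m. has_caustics \<alpha> C (a m) \<and> has_caustics \<alpha> C (b m)"
    and skew: "skew_lines \<alpha> C s (a 0) (b 0)"
    and minimal: "minimal_trajectory_via \<alpha> C s \<Lambda> (a 0) (b 0)"
  shows "\<forall>m. skew_lines \<alpha> C s (a m) (b m) \<and> minimal_trajectory_via \<alpha> C s \<Lambda> (a m) (b m)"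
proof -
  have C: "\<forall>c\<in>C. regular_param \<alpha> c" using caustics by (simp add: caustic_params_def)
  \<comment> \<open>Stated for every list \<open>\<Gamma>\<close>, since the minimality in
    \<open>skew_lines\<close> quantifies over all connecting lists.\<close>
  have *: "connects_via \<alpha> C \<Gamma> (a m) (b m) \<longleftrightarrow> connects_via \<alpha> C \<Gamma> (a 0) (b 0)" for m \<Gamma>
  proof (induction m rule: int_induct[where k = 0])
    case (step1 i)
    then show ?case using connects_via_billiard_step[OF traj_a traj_b ellipsoid C, of _ i] by simp
  next
    case (step2 i)
    \<comment> \<open>Downward induction reads the step equivalence at \<open>i - 1\<close> from
      right to left in the index.\<close>
    then show ?case using connects_via_billiard_step[OF traj_a traj_b ellipsoid C, of _ "i - 1"] by simp
  qed simp
  show ?thesis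
  proof
    fix m
    show "skew_lines \<alpha> C s (a m) (b m) \<and> minimal_trajectory_via \<alpha> C s \<Lambda> (a m) (b m)"
      using skew minimal unfolding minimal_trajectory_via_def skew_lines_def *[of _ m] by blast
  qed
qed

end
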